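(* Let $\{C_i\}_{i\in\mathbb{N}}$ be a sequence of convex bodies in $\mathbb{R}^{n+1}$ that converges to a convex body $C\subset\mathbb{R}^{n+1}$ in the Hausdorff topology. Then $J_{C_i}$ converges to $J_C$ uniformly on compact subsets of $(0,1)$, and $y_{C_i}$ converges to $y_C$ uniformly on compact subsets of $(0,1)$.
   Context: Here $n\ge 1$. A convex body in $\mathbb{R}^{n+1}$ is a compact convex set with non-empty interior. The Hausdorff topology is that of the Hausdorff distance $\delta(C,C')=\inf\{r>0: C\subset (C')_r,\ C'\subset C_r\}$, where $C_r$ is the set of points at Euclidean distance at most $r$ from $C$. $|E|$ denotes $(n+1)$-dimensional Lebesgue measure. For measurable $E\subset C$, the relative perimeter is $P_C(E)=\sup\{\int_E \mathrm{div}\,\xi : \xi \text{ smooth vector field with compact support in } \mathrm{int}(C),\ |\xi|\le 1\}$. The isoperimetric profile is $I_C(v)=\inf\{P_C(E): E\subset C,\ |E|=v\}$ for $0\le v\le |C|$. The normalized profiles are $J_C:[0,1]\to[0,\infty)$, $J_C(\lambda)=I_C(\lambda |C|)$, and $y_C=J_C^{(n+1)/n}$. *)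

theory Defs
  imports "HOL-Analysis.Analysis"
begin

text \<open>
  The ambient space \<open>\<real>\<^sup>n\<^sup>+\<^sup>1\<close> is a type \<open>'a :: euclidean_space\<close> with \<open>DIM('a) = n + 1\<close>; the
  condition \<open>n \<ge> 1\<close> becomes \<open>DIM('a) \<ge> 2\<close>.
\<close>

definition convex_body :: "'a::euclidean_space set \<Rightarrow> bool" where
  "convex_body C \<longleftrightarrow> compact C \<and> convex C \<and> interior C \<noteq> {}"

definition closed_nbhd :: "real \<Rightarrow> 'a::euclidean_space set \<Rightarrow> 'a set" where
  "closed_nbhd r C = {x. infdist x C \<le> r}"

definition hausdorff_dist :: "'a::euclidean_space set \<Rightarrow> 'a set \<Rightarrow> real" where
  "hausdorff_dist C C' = Inf {r. 0 < r \<and> C \<subseteq> closed_nbhd r C' \<and> C' \<subseteq> closed_nbhd r C}"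

text \<open>
  \<open>C_differentiable k f\<close>: all iterated directional derivatives of \<open>f\<close> of order up to \<open>k\<close> exist
  (each stage being Frechet differentiable) and those of order \<open>k\<close> are continuous. In finite
  dimension this is the class \<open>C\<^sup>k\<close>.
\<close>

primrec C_differentiable ::
  "nat \<Rightarrow> ('a::euclidean_space \<Rightarrow> 'b::real_normed_vector) \<Rightarrow> bool" where
  "C_differentiable 0 f \<longleftrightarrow> continuous_on UNIV f"
| "C_differentiable (Suc k) f \<longleftrightarrow>
     (\<forall>x. f differentiable (at x)) \<and>
     (\<forall>v. C_differentiable k (\<lambda>x. frechet_derivative f (at x) v))"

definition smooth :: "('a::euclidean_space \<Rightarrow> 'b::real_normed_vector) \<Rightarrow> bool" where
  "smooth f \<longleftrightarrow> (\<forall>k. C_differentiable k f)"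

definition divergence :: "('a::euclidean_space \<Rightarrow> 'a) \<Rightarrow> 'a \<Rightarrow> real" where
  "divergence \<xi> x = (\<Sum>b\<in>Basis. frechet_derivative \<xi> (at x) b \<bullet> b)"

text \<open>
  A field with compact support in \<open>interior C\<close> is represented by its extension by zero to the
  whole space.
\<close>

definition test_fields :: "'a::euclidean_space set \<Rightarrow> ('a \<Rightarrow> 'a) set" where
  "test_fields C = {\<xi>. smooth \<xi> \<and> compact (closure {x. \<xi> x \<noteq> 0}) \<and>
     closure {x. \<xi> x \<noteq> 0} \<subseteq> interior C \<and> (\<forall>x. norm (\<xi> x) \<le> 1)}"

definition rel_perimeter :: "'a::euclidean_space set \<Rightarrow> 'a set \<Rightarrow> ereal" where
  "rel_perimeter C E = (SUP \<xi>\<in>test_fields C. ereal (LINT x:E|lebesgue. divergence \<xi> x))"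

definition iso_profile :: "'a::euclidean_space set \<Rightarrow> real \<Rightarrow> ereal" where
  "iso_profile C v =
     (INF E\<in>{E. E \<in> sets lebesgue \<and> E \<subseteq> C \<and> measure lebesgue E = v}. rel_perimeter C E)"

text \<open>
  For a convex body \<open>C\<close> and \<open>0 \<le> t \<le> 1\<close> the profile at \<open>t |C|\<close> is nonnegative (the zero field
  is a test field) and finite (cut \<open>C\<close> by a half-space), so the conversion to \<open>real\<close> loses
  nothing. Values at other \<open>t\<close> are irrelevant.
\<close>

definition norm_profile :: "'a::euclidean_space set \<Rightarrow> real \<Rightarrow> real" where
  "norm_profile C t = real_of_ereal (iso_profile C (t * measure lebesgue C))"

text \<open>The exponent is \<open>(n + 1) / n\<close> with \<open>n + 1 = DIM('a)\<close>.\<close>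

definition norm_profile_pow :: "'a::euclidean_space set \<Rightarrow> real \<Rightarrow> real" where
  "norm_profile_pow C t = norm_profile C t powr (real DIM('a) / (real DIM('a) - 1))"

end

theory Submission
  imports Defs
begin

text \<open>
  The proof compares the profiles of nested sets. Convexity enters through the following fact: if convex bodies
  \<open>C i\<close> converge to \<open>L\<close> and \<open>x0\<close> is interior to \<open>L\<close>, then for every \<open>s\<close> in \<open>(0, 1)\<close> the body \<open>C i\<close>
  eventually lies between the homothetic copies of \<open>L\<close> with centre \<open>x0\<close> and ratios \<open>1 - s\<close> and \<open>1 + s\<close>
  (\<open>eventually_sandwich\<close>).

  Let \<open>D \<subseteq> C\<close>. Restricting a competitor \<open>E \<subseteq> C\<close> to \<open>D\<close> does not increase its relative perimeter, because test
  fields of \<open>D\<close> are test fields of \<open>C\<close> (\<open>rel_perimeter_subset_le\<close>). When \<open>C - D\<close> has small volume,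
  \<open>E \<inter> D\<close> occupies almost the same fraction of \<open>D\<close> as \<open>E\<close> does of \<open>C\<close>, and it remains to correct a small
  error in the volume. This is done by adding or removing a small cube of half side \<open>r\<close>, at a cost in perimeter of
  order \<open>r\<^sup>n\<close>, where \<open>n + 1\<close> is the dimension; since \<open>n \<ge> 1\<close>, the cost is small. By the pigeonhole principle some
  cube among finitely many of this size meets the set to be changed in a definite volume, and by continuity a
  concentric smaller cube gives exactly the required change (\<open>adjust_volume\<close>). The constants are the same for all
  sets inside a given bounded region, so the resulting inequality \<open>J\<^sub>D \<le> J\<^sub>C + \<eta>\<close> on compact subsets of
  \<open>(0, 1)\<close> is uniform (\<open>iso_profile_subset_le\<close>). Apply it to both inclusions of the sandwich, and use that
  a homothety of ratio \<open>l\<close> multiplies the normalized profile by \<open>l\<^sup>n\<close> (\<open>norm_profile_affine\<close>): the profiles of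
  \<open>C i\<close> and \<open>L\<close> then differ by an arbitrarily small amount. The statement on powers of the profiles
  follows from uniform continuity of the power function on compact intervals.

  The cost estimate uses the explicit functions \<open>exp (- \<Sum>\<^sub>b ((x - c) \<bullet> b / r)\<^sup>2\<^sup>k)\<close>, which are smooth, take
  values in \<open>[0, 1]\<close> and converge to the indicator of the cube as \<open>k\<close> grows, while the integrals of their gradients
  are bounded by a multiple of \<open>r\<^sup>n\<close> independent of \<open>k\<close>. Multiplying a test field by such a function or by its
  complement to \<open>1\<close> gives test fields that, in the limit, see only the inside or only the outside of the
  cube.
\<close>

section \<open>Calculus of smooth maps\<close>

text \<open>
  The operator \<open>frechet_derivative\<close> is defined by a choice; this rule lets one exhibit the derivative
  instead.
\<close>

lemma C_differentiable_SucI: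
  assumes "\<And>x. (f has_derivative F x) (at x)"
    and "\<And>v. C_differentiable k (\<lambda>x. F x v)"
  shows "C_differentiable (Suc k) f"
proof -
  have "frechet_derivative f (at x) = F x" for x
    using frechet_derivative_at[OF assms(1)] by simp
  then show ?thesis
    using assms by (auto simp: differentiable_def)
qed

lemma C_differentiable_has_derivative:
  "C_differentiable (Suc k) f \<Longrightarrow> (f has_derivative frechet_derivative f (at x)) (at x)"
  by (simp add: frechet_derivative_works)

lemma C_differentiable_SucD: "C_differentiable (Suc k) f \<Longrightarrow> C_differentiable k f"
proof (induction k arbitrary: f)
  case 0
  then show ?case
    by (auto intro!: continuous_at_imp_continuous_on differentiable_imp_continuous_within)
next
  case (Suc k)
  then show ?case by (metis C_differentiable.simps(2))
qed

lemma C_differentiable_const: "C_differentiable k (\<lambda>x. c)"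
proof (induction k arbitrary: c)
  case (Suc k)
  show ?case
    by (rule C_differentiable_SucI[where F = "\<lambda>x v. 0"]) (simp_all add: Suc)
qed simp

lemma C_differentiable_add:
  "C_differentiable k f \<Longrightarrow> C_differentiable k g \<Longrightarrow> C_differentiable k (\<lambda>x. f x + g x)"
proof (induction k arbitrary: f g)
  case 0
  then show ?case by (simp add: continuous_on_add)
next
  case (Suc k)
  show ?case
  proof (rule C_differentiable_SucI)
    show "((\<lambda>x. f x + g x) has_derivative
        (\<lambda>v. frechet_derivative f (at x) v + frechet_derivative g (at x) v)) (at x)" for x
      using Suc.prems[THEN C_differentiable_has_derivative] by (intro has_derivative_add)
    show "C_differentiable k (\<lambda>x. frechet_derivative f (at x) v + frechet_derivative g (at x) v)" for v
      using Suc by simp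
  qed
qed

lemma C_differentiable_scaleR:
  fixes f :: "'a::euclidean_space \<Rightarrow> real" and g :: "'a \<Rightarrow> 'b::real_normed_vector"
  shows "C_differentiable k f \<Longrightarrow> C_differentiable k g \<Longrightarrow> C_differentiable k (\<lambda>x. f x *\<^sub>R g x)"
proof (induction k arbitrary: f g)
  case 0
  then show ?case by (simp add: continuous_on_scaleR)
next
  case (Suc k)
  show ?case
  proof (rule C_differentiable_SucI)
    show "((\<lambda>x. f x *\<^sub>R g x) has_derivative
        (\<lambda>v. f x *\<^sub>R frechet_derivative g (at x) v + frechet_derivative f (at x) v *\<^sub>R g x)) (at x)" for x
      using Suc.prems[THEN C_differentiable_has_derivative]
      by (intro has_derivative_scaleR)
    show "C_differentiable k
        (\<lambda>x. f x *\<^sub>R frechet_derivative g (at x) v + frechet_derivative f (at x) v *\<^sub>R g x)" for v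
      using Suc.prems by (intro C_differentiable_add Suc.IH C_differentiable_SucD[OF Suc.prems(1)]
        C_differentiable_SucD[OF Suc.prems(2)]) auto
  qed
qed

text \<open>
  The derivative is, up to the factor \<open>l\<close>, a derivative of \<open>f\<close> composed with the same affine map, so the
  induction hypothesis applies to it.
\<close>

lemma C_differentiable_compose_affine:
  "C_differentiable k f \<Longrightarrow> C_differentiable k (\<lambda>x. f (l *\<^sub>R x + a))"
proof (induction k arbitrary: f)
  case 0
  then have "continuous_on UNIV (f \<circ> (\<lambda>x. l *\<^sub>R x + a))"
    by (intro continuous_on_compose continuous_intros)
       (use 0 continuous_on_subset in \<open>auto simp: C_differentiable.simps\<close>)
  then show ?case by (simp add: o_def)
next
  case (Suc k)
  show ?case
  proof (rule C_differentiable_SucI)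
    fix x
    have *: "((\<lambda>x. l *\<^sub>R x + a) has_derivative (\<lambda>v. l *\<^sub>R v)) (at x)"
      by (auto intro!: derivative_eq_intros)
    have f: "(f has_derivative frechet_derivative f (at (l *\<^sub>R x + a))) (at (l *\<^sub>R x + a))"
      by (rule C_differentiable_has_derivative[OF Suc.prems])
    have "((\<lambda>x. f (l *\<^sub>R x + a)) has_derivative
        (\<lambda>v. frechet_derivative f (at (l *\<^sub>R x + a)) (l *\<^sub>R v))) (at x)"
      using has_derivative_compose[OF * f] .
    also have "(\<lambda>v. frechet_derivative f (at (l *\<^sub>R x + a)) (l *\<^sub>R v)) =
        (\<lambda>v. l *\<^sub>R frechet_derivative f (at (l *\<^sub>R x + a)) v)"
      by (simp add: linear_cmul[OF has_derivative_linear[OF f]])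
    finally show "((\<lambda>x. f (l *\<^sub>R x + a)) has_derivative
        (\<lambda>v. l *\<^sub>R frechet_derivative f (at (l *\<^sub>R x + a)) v)) (at x)" .
  next
    show "C_differentiable k (\<lambda>x. l *\<^sub>R frechet_derivative f (at (l *\<^sub>R x + a)) v)" for v
      using Suc by (intro C_differentiable_scaleR C_differentiable_const Suc.IH) auto
  qed
qed

text \<open>
  The derivative of \<open>exp \<circ> f\<close> is \<open>exp \<circ> f\<close> times a derivative of \<open>f\<close>, so the induction reduces to the
  product rule. All cutoff functions below are exponentials of polynomials; multiplied by a test field
  they inherit its compact support.
\<close>

lemma C_differentiable_exp:
  fixes f :: "'a::euclidean_space \<Rightarrow> real"
  shows "C_differentiable k f \<Longrightarrow> C_differentiable k (\<lambda>x. exp (f x))"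
proof (induction k arbitrary: f)
  case 0
  then show ?case by (simp add: continuous_on_exp)
next
  case (Suc k)
  show ?case
  proof (rule C_differentiable_SucI)
    show "((\<lambda>x. exp (f x)) has_derivative (\<lambda>v. exp (f x) *\<^sub>R frechet_derivative f (at x) v)) (at x)" for x
      using C_differentiable_has_derivative[OF Suc.prems]
      by (auto intro!: derivative_eq_intros)
    show "C_differentiable k (\<lambda>x. exp (f x) *\<^sub>R frechet_derivative f (at x) v)" for v
      using Suc.prems by (intro C_differentiable_scaleR Suc.IH C_differentiable_SucD[OF Suc.prems]) auto
  qed
qed

lemma C_differentiable_ident: "C_differentiable k (\<lambda>x. x)"
proof (cases k)
  case (Suc j)
  show ?thesis unfolding Suc
    by (rule C_differentiable_SucI[where F = "\<lambda>x v. v"]) (simp_all add: C_differentiable_const)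
qed simp

lemma C_differentiable_inner_left:
  fixes f :: "'a::euclidean_space \<Rightarrow> 'b::real_inner"
  shows "C_differentiable k f \<Longrightarrow> C_differentiable k (\<lambda>x. f x \<bullet> b)"
proof (induction k arbitrary: f)
  case 0
  then show ?case by (simp add: continuous_on_inner)
next
  case (Suc k)
  show ?case
    by (rule C_differentiable_SucI[OF has_derivative_inner_left[OF C_differentiable_has_derivative[OF Suc.prems]]])
       (use Suc in auto)
qed

lemma smooth_const: "smooth (\<lambda>x. c)"
  by (simp add: smooth_def C_differentiable_const)

lemma smooth_add: "smooth f \<Longrightarrow> smooth g \<Longrightarrow> smooth (\<lambda>x. f x + g x)"
  by (simp add: smooth_def C_differentiable_add)

lemma smooth_scaleR:
  fixes f :: "'a::euclidean_space \<Rightarrow> real"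
  shows "smooth f \<Longrightarrow> smooth g \<Longrightarrow> smooth (\<lambda>x. f x *\<^sub>R g x)"
  by (simp add: smooth_def C_differentiable_scaleR)

lemma smooth_mult:
  fixes f g :: "'a::euclidean_space \<Rightarrow> real"
  shows "smooth f \<Longrightarrow> smooth g \<Longrightarrow> smooth (\<lambda>x. f x * g x)"
  using smooth_scaleR[of f g] by simp

lemma smooth_sum: "(\<And>i. i \<in> I \<Longrightarrow> smooth (f i)) \<Longrightarrow> smooth (\<lambda>x. \<Sum>i\<in>I. f i x)"
  by (induction I rule: infinite_finite_induct) (simp_all add: smooth_const smooth_add)

lemma smooth_power:
  fixes f :: "'a::euclidean_space \<Rightarrow> real"
  shows "smooth f \<Longrightarrow> smooth (\<lambda>x. f x ^ m)"
  by (induction m) (simp_all add: smooth_const smooth_mult)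

lemma smooth_exp:
  fixes f :: "'a::euclidean_space \<Rightarrow> real"
  shows "smooth f \<Longrightarrow> smooth (\<lambda>x. exp (f x))"
  by (simp add: smooth_def C_differentiable_exp)

lemma smooth_ident: "smooth (\<lambda>x. x)"
  by (simp add: smooth_def C_differentiable_ident)

lemma smooth_inner_left:
  fixes f :: "'a::euclidean_space \<Rightarrow> 'b::real_inner"
  shows "smooth f \<Longrightarrow> smooth (\<lambda>x. f x \<bullet> b)"
  by (simp add: smooth_def C_differentiable_inner_left)

lemma smooth_compose_affine: "smooth f \<Longrightarrow> smooth (\<lambda>x. f (l *\<^sub>R x + a))"
  by (simp add: smooth_def C_differentiable_compose_affine)

lemma smooth_has_derivative:
  "smooth f \<Longrightarrow> (f has_derivative frechet_derivative f (at x)) (at x)"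
  unfolding smooth_def by (metis C_differentiable_has_derivative)

lemma continuous_on_smooth: "smooth f \<Longrightarrow> continuous_on S f"
  unfolding smooth_def by (metis C_differentiable.simps(1) continuous_on_subset subset_UNIV)

lemma continuous_on_frechet_derivative_smooth:
  assumes "smooth f"
  shows "continuous_on S (\<lambda>x. frechet_derivative f (at x) v)"
proof -
  have "C_differentiable (Suc 0) f" using assms by (simp only: smooth_def)
  then have "continuous_on UNIV (\<lambda>x. frechet_derivative f (at x) v)" by simp
  then show ?thesis by (rule continuous_on_subset) simp
qed

lemma smooth_uminus:
  fixes f :: "'a::euclidean_space \<Rightarrow> real"
  shows "smooth f \<Longrightarrow> smooth (\<lambda>x. - f x)"
  using smooth_mult[OF smooth_const[of "-1"], of f] by simp

lemma smooth_diff: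
  fixes f g :: "'a::euclidean_space \<Rightarrow> real"
  shows "smooth f \<Longrightarrow> smooth g \<Longrightarrow> smooth (\<lambda>x. f x - g x)"
  using smooth_add[OF _ smooth_uminus, of f g] by simp

section \<open>Compactly supported fields and their divergence\<close>

lemma frechet_derivative_outside_support:
  fixes f :: "'a::euclidean_space \<Rightarrow> 'b::real_normed_vector"
  assumes "x \<notin> closure {x. f x \<noteq> 0}"
  shows "frechet_derivative f (at x) = (\<lambda>v. 0)"
proof -
  have "(f has_derivative (\<lambda>v. 0)) (at x)"
  proof (rule has_derivative_transform_within_open[where f = "\<lambda>x. 0"])
    show "open (- closure {x. f x \<noteq> 0})" "x \<in> - closure {x. f x \<noteq> 0}" using assms by auto
    show "0 = f y" if "y \<in> - closure {x. f x \<noteq> 0}" for y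
      using that closure_subset[of "{x. f x \<noteq> 0}"] by auto
  qed simp
  then show ?thesis by (metis frechet_derivative_at)
qed

lemma integrable_lborel_compact_support:
  fixes f :: "'a::euclidean_space \<Rightarrow> real"
  assumes "compact S" "continuous_on UNIV f" "\<And>x. x \<notin> S \<Longrightarrow> f x = 0"
  shows "integrable lborel f"
proof -
  have "integrable lborel (\<lambda>x. indicator S x *\<^sub>R f x)"
    using assms(1) continuous_on_subset[OF assms(2) subset_UNIV] by (rule borel_integrable_compact)
  also have "(\<lambda>x. indicator S x *\<^sub>R f x) = f"
    using assms(3) by (intro ext) (auto simp: indicator_def)
  finally show ?thesis .
qed

text \<open>
  Translation invariance of the integral makes the integral of every difference quotient of \<open>f\<close>
  in the direction \<open>b\<close> vanish, and dominated convergence passes this to the derivative.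
\<close>

lemma integral_directional_derivative_eq_0:
  fixes f :: "'a::euclidean_space \<Rightarrow> real"
  assumes "smooth f" and comp: "compact (closure {x. f x \<noteq> 0})"
  shows "(LINT x|lborel. frechet_derivative f (at x) b) = 0"
proof -
  define S where "S = closure {x. f x \<noteq> 0}"
  define D where "D = (\<lambda>x. frechet_derivative f (at x) b)"
  define T where "T = (\<lambda>(t, s). s + t *\<^sub>R b) ` ({-1..1::real} \<times> S)"
  have S0: "f x = 0" if "x \<notin> S" for x
    using that closure_subset[of "{x. f x \<noteq> 0}"] unfolding S_def by auto
  have D0: "D x = 0" if "x \<notin> S" for x
    using that frechet_derivative_outside_support[of x f] unfolding S_def D_def by simp
  have contf: "continuous_on UNIV f" and contD: "continuous_on UNIV D"
    using assms(1) by (auto simp: D_def continuous_on_smooth continuous_on_frechet_derivative_smooth)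
  have compS: "compact S" using comp by (simp add: S_def)
  have compT: "compact T" unfolding T_def
    by (intro compact_continuous_image compact_Times compS)
       (auto intro!: continuous_intros simp: case_prod_beta)
  have "bounded (D ` S)"
    using compS contD by (meson compact_continuous_image compact_imp_bounded continuous_on_subset subset_UNIV)
  then obtain M where M: "M > 0" "\<And>x. x \<in> S \<Longrightarrow> \<bar>D x\<bar> \<le> M"
    unfolding bounded_pos by auto
  have M': "\<bar>D x\<bar> \<le> M" for x
    using M D0[of x] by (cases "x \<in> S") auto
  have Df: "(f has_derivative frechet_derivative f (at x)) (at x)" for x
    by (rule smooth_has_derivative[OF assms(1)])
  have line: "((\<lambda>t. f (x + t *\<^sub>R b)) has_real_derivative D (x + t *\<^sub>R b)) (at t)" for x t
  proof -
    have *: "((\<lambda>t. x + t *\<^sub>R b) has_derivative (\<lambda>h. h *\<^sub>R b)) (at t)"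
      by (auto intro!: derivative_eq_intros)
    have "((\<lambda>t. f (x + t *\<^sub>R b)) has_derivative
        (\<lambda>h. frechet_derivative f (at (x + t *\<^sub>R b)) (h *\<^sub>R b))) (at t)"
      by (rule has_derivative_compose[OF * Df])
    then show ?thesis
      by (simp add: has_field_derivative_def D_def linear_cmul[OF has_derivative_linear[OF Df]]
          mult.commute[of _ "frechet_derivative f _ _"])
  qed
  define q where "q = (\<lambda>(n::nat) x. (f (x + (1 / real (Suc n)) *\<^sub>R b) - f x) / (1 / real (Suc n)))"
  have q_lim: "(\<lambda>n. q n x) \<longlonglongrightarrow> D x" for x
  proof -
    have "((\<lambda>h. (f (x + h *\<^sub>R b) - f x) / h) \<longlongrightarrow> D x) (at 0)"
      using line[of x 0] by (simp add: DERIV_def)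
    moreover have "filterlim (\<lambda>n. 1 / real (Suc n)) (at 0) sequentially"
      using LIMSEQ_Suc[OF lim_1_over_n] by (auto simp: filterlim_at)
    ultimately show ?thesis
      unfolding q_def by (rule filterlim_compose)
  qed
  \<comment> \<open>by the mean value theorem; the difference quotients live on the sum \<open>T\<close> of \<open>S\<close> and a segment\<close>
  have q_bound: "\<bar>q n x\<bar> \<le> M * indicator T x" for n x
  proof -
    define h where "h = 1 / real (Suc n)"
    have h: "0 < h" "h \<le> 1" by (auto simp: h_def divide_simps)
    obtain z where z: "0 < z" "z < h" "f (x + h *\<^sub>R b) - f (x + 0 *\<^sub>R b) = (h - 0) * D (x + z *\<^sub>R b)"
      using MVT2[OF h(1), of "\<lambda>t. f (x + t *\<^sub>R b)" "\<lambda>t. D (x + t *\<^sub>R b)"] line by blast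
    then have "q n x = D (x + z *\<^sub>R b)"
      using h unfolding q_def h_def[symmetric] by (simp add: field_simps)
    moreover have "x \<in> T" if "x + z *\<^sub>R b \<in> S"
      unfolding T_def using that z h
      by (intro image_eqI[where x = "(- z, x + z *\<^sub>R b)"]) auto
    ultimately show ?thesis
      using M'[of "x + z *\<^sub>R b"] D0[of "x + z *\<^sub>R b"] \<open>M > 0\<close> by (auto simp: indicator_def)
  qed
  have intf: "integrable lborel f"
    by (rule integrable_lborel_compact_support[OF compS contf S0])
  have q_int: "(LINT x|lborel. q n x) = 0" for n
  proof -
    define h where "h = 1 / real (Suc n)"
    have *: "lborel = distr lborel borel (\<lambda>x. h *\<^sub>R b + x)"
      using lborel_distr_plus[of "h *\<^sub>R b"] by simp
    have "integrable (distr lborel borel (\<lambda>x. h *\<^sub>R b + x)) f"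
      using intf * by simp
    then have int': "integrable lborel (\<lambda>x. f (x + h *\<^sub>R b))"
      by (subst (asm) integrable_distr_eq)
         (use contf in \<open>auto intro!: borel_measurable_continuous_onI simp: add.commute\<close>)
    have "(LINT x|lborel. f x) = (LINT x|distr lborel borel (\<lambda>x. h *\<^sub>R b + x). f x)"
      using * by simp
    also have "\<dots> = (LINT x|lborel. f (x + h *\<^sub>R b))"
      by (subst integral_distr)
         (use contf in \<open>auto intro!: borel_measurable_continuous_onI simp: add.commute\<close>)
    finally show ?thesis
      using intf int' unfolding q_def h_def[symmetric] by simp
  qed
  have "(\<lambda>n. LINT x|lborel. q n x) \<longlonglongrightarrow> (LINT x|lborel. D x)"
  proof (rule integral_dominated_convergence[where w = "\<lambda>x. M * indicator T x"])
    show "D \<in> borel_measurable lborel"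
      using contD by (auto intro: borel_measurable_continuous_onI)
    show "q n \<in> borel_measurable lborel" for n
      unfolding q_def using contf
      by (auto intro!: borel_measurable_continuous_onI continuous_intros continuous_on_compose2[OF contf])
    show "integrable lborel (\<lambda>x. M * indicator T x)"
      using compT emeasure_compact_finite[OF compT]
      by (auto intro!: integrable_mult_right integrable_real_indicator simp: borel_compact)
  qed (use q_lim q_bound in auto)
  then show ?thesis
    by (simp add: q_int LIMSEQ_const_iff D_def)
qed

lemma continuous_on_divergence: "smooth \<xi> \<Longrightarrow> continuous_on S (divergence \<xi>)"
  unfolding divergence_def
  by (intro continuous_intros continuous_on_frechet_derivative_smooth)

lemma divergence_outside_support: "x \<notin> closure {x. \<xi> x \<noteq> 0} \<Longrightarrow> divergence \<xi> x = 0"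
  by (simp add: divergence_def frechet_derivative_outside_support)

text \<open>
  The product rule \<open>div (\<phi> \<xi>) = \<phi> div \<xi> + \<nabla>\<phi> \<bullet> \<xi>\<close>, with the gradient written as a
  Frechet derivative.
\<close>

lemma divergence_scaleR:
  assumes "smooth \<phi>" "smooth \<xi>"
  shows "divergence (\<lambda>x. \<phi> x *\<^sub>R \<xi> x) x = \<phi> x * divergence \<xi> x + frechet_derivative \<phi> (at x) (\<xi> x)"
proof -
  let ?D = "frechet_derivative \<phi> (at x)"
  have D: "frechet_derivative (\<lambda>x. \<phi> x *\<^sub>R \<xi> x) (at x) =
      (\<lambda>v. \<phi> x *\<^sub>R frechet_derivative \<xi> (at x) v + ?D v *\<^sub>R \<xi> x)"
    using assms by (intro frechet_derivative_at[symmetric] has_derivative_scaleR smooth_has_derivative)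
  have lin: "linear ?D"
    using smooth_has_derivative[OF assms(1)] has_derivative_linear by blast
  have "?D (\<xi> x) = ?D (\<Sum>b\<in>Basis. (\<xi> x \<bullet> b) *\<^sub>R b)"
    by (simp add: euclidean_representation)
  also have "\<dots> = (\<Sum>b\<in>Basis. ?D b * (\<xi> x \<bullet> b))"
    using lin by (simp add: linear_sum linear_cmul mult.commute)
  finally show ?thesis
    by (simp add: divergence_def D inner_add_left sum.distrib sum_distrib_left)
qed

lemma integrable_divergence:
  assumes "smooth \<xi>" "compact (closure {x. \<xi> x \<noteq> 0})"
  shows "integrable lebesgue (divergence \<xi>)"
proof -
  have cont: "continuous_on UNIV (divergence \<xi>)"
    using assms(1) by (rule continuous_on_divergence)
  then have "integrable lborel (divergence \<xi>)"
    using assms(2) divergence_outside_support by (intro integrable_lborel_compact_support)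
  then show ?thesis
    using cont by (subst integrable_completion) (auto intro: borel_measurable_continuous_onI)
qed

text \<open>
  The divergence theorem for compactly supported fields. It says that the whole space has perimeter
  zero, and it is what bounds the perimeter of a cube from above.
\<close>

lemma integral_divergence_eq_0:
  assumes "smooth \<xi>" "compact (closure {x. \<xi> x \<noteq> 0})"
  shows "(LINT x|lebesgue. divergence \<xi> x) = 0"
proof -
  have D: "frechet_derivative (\<lambda>x. \<xi> x \<bullet> b) (at x) = (\<lambda>v. frechet_derivative \<xi> (at x) v \<bullet> b)" for b x
    using assms by (intro frechet_derivative_at[symmetric] has_derivative_inner_left smooth_has_derivative)
  have smooth_comp: "smooth (\<lambda>x. \<xi> x \<bullet> b)" for b
    using assms(1) by (rule smooth_inner_left)
  have supp: "closure {x. \<xi> x \<bullet> b \<noteq> 0} \<subseteq> closure {x. \<xi> x \<noteq> 0}" for b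
    by (intro closure_mono) auto
  have comp: "compact (closure {x. \<xi> x \<bullet> b \<noteq> 0})" for b
    using supp[of b] assms(2) by (meson closed_closure compact_Int_closed compact_eq_bounded_closed bounded_subset)
  have int: "integrable lborel (\<lambda>x. frechet_derivative (\<lambda>x. \<xi> x \<bullet> b) (at x) b)" for b
    by (rule integrable_lborel_compact_support[OF comp[of b]])
       (simp_all add: frechet_derivative_outside_support continuous_on_frechet_derivative_smooth smooth_comp)
  have "(LINT x|lebesgue. divergence \<xi> x) = (LINT x|lborel. divergence \<xi> x)"
    using continuous_on_divergence[OF assms(1)]
    by (intro integral_completion) (auto intro: borel_measurable_continuous_onI)
  also have "\<dots> = (\<Sum>b\<in>Basis. LINT x|lborel. frechet_derivative (\<lambda>x. \<xi> x \<bullet> b) (at x) b)"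
    using int by (simp add: divergence_def D)
  also have "\<dots> = 0"
    using integral_directional_derivative_eq_0[OF smooth_comp comp] by simp
  finally show ?thesis .
qed

section \<open>Smooth approximations of the indicator of a cube\<close>

text \<open>
  The letter \<open>r\<close> is half of the side length, so that \<open>cube c r\<close> is the closed ball of radius \<open>r\<close> of the
  maximum norm. Cubes are preferred to Euclidean balls because their cutoff functions factorise.
\<close>

definition cube :: "'a::euclidean_space \<Rightarrow> real \<Rightarrow> 'a set" where
  "cube c r = cbox (c - r *\<^sub>R One) (c + r *\<^sub>R One)"

lemma mem_cube: "x \<in> cube c r \<longleftrightarrow> (\<forall>b\<in>Basis. \<bar>(x - c) \<bullet> b\<bar> \<le> r)"
  unfolding cube_def mem_box by (intro ball_cong) (auto simp: inner_diff_left inner_add_left)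

lemma cube_lebesgue [measurable, simp]: "cube c r \<in> sets lebesgue" "cube c r \<in> lmeasurable"
  by (simp_all add: cube_def)

text \<open>
  For large \<open>k\<close> this function is close to \<open>1\<close> in the interior of the cube and close to \<open>0\<close> outside.
  It is a product of functions of one variable, so the integral of its gradient splits into
  one-dimensional integrals.
\<close>

definition cube_cutoff :: "'a::euclidean_space \<Rightarrow> real \<Rightarrow> nat \<Rightarrow> 'a \<Rightarrow> real" where
  "cube_cutoff c r k x = exp (- (\<Sum>b\<in>Basis. (((x - c) \<bullet> b) / r) ^ (2 * k)))"

text \<open>
  The sum of the absolute values of the partial derivatives of the cutoff function, an upper bound
  for its derivative in every direction of norm at most \<open>1\<close>.
\<close>

definition cube_cutoff_slope :: "'a::euclidean_space \<Rightarrow> real \<Rightarrow> nat \<Rightarrow> 'a \<Rightarrow> real" where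
  "cube_cutoff_slope c r k x = cube_cutoff c r k x *
     (\<Sum>b\<in>Basis. (2 * real k / r) * \<bar>((x - c) \<bullet> b) / r\<bar> ^ (2 * k - 1))"

lemma smooth_cube_cutoff: "smooth (cube_cutoff c r k)"
proof -
  have eq: "cube_cutoff c r k =
      (\<lambda>x. exp (- (\<Sum>b\<in>Basis. ((1 / r) * (x \<bullet> b) + - (c \<bullet> b) / r) ^ (2 * k))))"
    by (intro ext) (simp add: cube_cutoff_def inner_diff_left diff_divide_distrib)
  show ?thesis unfolding eq
    by (intro smooth_exp smooth_uminus smooth_sum smooth_power smooth_add smooth_mult
        smooth_const smooth_inner_left smooth_ident)
qed

lemma cube_cutoff_bounds: "0 \<le> cube_cutoff c r k x" "cube_cutoff c r k x \<le> 1"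
  by (auto simp: cube_cutoff_def intro!: sum_nonneg)

lemma abs_cube_cutoff_le_1: "\<bar>cube_cutoff c r k x\<bar> \<le> 1" "\<bar>1 - cube_cutoff c r k x\<bar> \<le> 1"
  using cube_cutoff_bounds[of c r k x] by auto

lemma abs_derivative_cube_cutoff_le:
  assumes "norm u \<le> 1" "r > 0"
  shows "\<bar>frechet_derivative (cube_cutoff c r k) (at x) u\<bar> \<le> cube_cutoff_slope c r k x"
proof -
  let ?D = "\<lambda>v. cube_cutoff c r k x *
      - (\<Sum>b\<in>Basis. real (2 * k) * (v \<bullet> b / r) * (((x - c) \<bullet> b) / r) ^ (2 * k - 1))"
  have "(cube_cutoff c r k has_derivative ?D) (at x)"
    unfolding cube_cutoff_def[abs_def]
    using assms(2)
    by (auto intro!: derivative_eq_intros simp: algebra_simps divide_inverse sum_distrib_left sum_negf)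
  then have D: "frechet_derivative (cube_cutoff c r k) (at x) = ?D"
    by (rule frechet_derivative_at[symmetric])
  have "\<bar>\<Sum>b\<in>Basis. real (2 * k) * (u \<bullet> b / r) * (((x - c) \<bullet> b) / r) ^ (2 * k - 1)\<bar>
      \<le> (\<Sum>b\<in>Basis. (2 * real k / r) * \<bar>((x - c) \<bullet> b) / r\<bar> ^ (2 * k - 1))"
  proof (rule order_trans[OF sum_abs], rule sum_mono)
    fix b :: 'a assume b: "b \<in> Basis"
    have "\<bar>u \<bullet> b\<bar> \<le> 1" using Basis_le_norm[OF b, of u] assms by simp
    then have "\<bar>u \<bullet> b\<bar> * (2 * real k / r * \<bar>((x - c) \<bullet> b) / r\<bar> ^ (2 * k - 1))
        \<le> 1 * (2 * real k / r * \<bar>((x - c) \<bullet> b) / r\<bar> ^ (2 * k - 1))"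
      using assms by (intro mult_right_mono) auto
    then show "\<bar>real (2 * k) * (u \<bullet> b / r) * (((x - c) \<bullet> b) / r) ^ (2 * k - 1)\<bar>
        \<le> (2 * real k / r) * \<bar>((x - c) \<bullet> b) / r\<bar> ^ (2 * k - 1)"
      using assms by (simp add: abs_mult power_abs abs_divide mult_ac)
  qed
  then show ?thesis
    using cube_cutoff_bounds[of c r k x]
    by (simp add: D cube_cutoff_slope_def abs_mult mult_left_mono)
qed

lemma cube_cutoff_tendsto_inside:
  assumes "\<And>b. b \<in> Basis \<Longrightarrow> \<bar>(x - c) \<bullet> b\<bar> < r"
  shows "(\<lambda>k. cube_cutoff c r k x) \<longlonglongrightarrow> 1"
proof -
  have "(\<lambda>k. (((x - c) \<bullet> b) / r) ^ (2 * k)) \<longlonglongrightarrow> 0" if "b \<in> Basis" for b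
  proof -
    have "\<bar>((x - c) \<bullet> b) / r\<bar> < 1"
      using assms[OF that] by (auto simp: divide_simps)
    then have "\<bar>(((x - c) \<bullet> b) / r)\<^sup>2\<bar> < 1"
      by (simp add: abs_square_less_1)
    then show ?thesis
      unfolding power_mult by (intro LIMSEQ_power_zero) simp
  qed
  then have "(\<lambda>k. \<Sum>b\<in>Basis. (((x - c) \<bullet> b) / r) ^ (2 * k)) \<longlonglongrightarrow> (\<Sum>b::'a\<in>Basis. 0)"
    by (rule tendsto_sum)
  then have "(\<lambda>k. cube_cutoff c r k x) \<longlonglongrightarrow> exp (- (\<Sum>b::'a\<in>Basis. 0))"
    unfolding cube_cutoff_def by (intro tendsto_exp tendsto_minus)
  then show ?thesis by simp
qed

lemma cube_cutoff_tendsto_outside: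
  assumes "x \<notin> cube c r" "r > 0"
  shows "(\<lambda>k. cube_cutoff c r k x) \<longlonglongrightarrow> 0"
proof -
  obtain b where b: "b \<in> Basis" "\<bar>(x - c) \<bullet> b\<bar> > r"
    using assms by (auto simp: mem_cube not_le)
  define u where "u = (((x - c) \<bullet> b) / r)\<^sup>2"
  have "\<bar>((x - c) \<bullet> b) / r\<bar> > 1" using b assms by (simp add: divide_simps)
  then have "u > 1" unfolding u_def by (metis abs_power2 one_less_power power2_abs pos2)
  have lim: "(\<lambda>k. inverse (u ^ k)) \<longlonglongrightarrow> 0"
    using LIMSEQ_inverse_realpow_zero[OF \<open>u > 1\<close>] .
  have "filterlim (\<lambda>k. u ^ k) at_top sequentially"
    using filterlim_realpow_sequentially_gt1[of u] \<open>u > 1\<close>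
    by (simp add: filterlim_at_infinity_imp_filterlim_at_top)
  then have "filterlim (\<lambda>k. - (u ^ k)) at_bot sequentially"
    by (simp add: filterlim_uminus_at_bot)
  then have exp_lim: "(\<lambda>k. exp (- (u ^ k))) \<longlonglongrightarrow> 0"
    by (rule filterlim_compose[OF exp_at_bot])
  show ?thesis
  proof (rule tendsto_sandwich[OF _ _ tendsto_const exp_lim])
    show "\<forall>\<^sub>F k in sequentially. cube_cutoff c r k x \<le> exp (- (u ^ k))"
    proof (intro always_eventually allI)
      fix k
      have "u ^ k = (((x - c) \<bullet> b) / r) ^ (2 * k)"
        by (simp add: u_def power_mult)
      also have "\<dots> \<le> (\<Sum>b\<in>Basis. (((x - c) \<bullet> b) / r) ^ (2 * k))"
        using b(1) by (intro member_le_sum) auto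
      finally show "cube_cutoff c r k x \<le> exp (- (u ^ k))"
        by (simp add: cube_cutoff_def)
    qed
  qed (simp add: cube_cutoff_bounds)
qed

text \<open>
  On the boundary of the cube the limit is \<open>exp (- m)\<close>, where \<open>m\<close> counts the coordinates with
  \<open>\<bar>(x - c) \<bullet> b\<bar> = r\<close>; the boundary is a null set.
\<close>

lemma AE_cube_cutoff_tendsto:
  assumes "r > 0"
  shows "AE x in lebesgue. (\<lambda>k. cube_cutoff c r k x) \<longlonglongrightarrow> indicator (cube c r) x"
proof -
  have "negligible (cube c r - box (c - r *\<^sub>R One) (c + r *\<^sub>R One))"
    unfolding cube_def by (rule negligible_frontier_interval)
  then have "AE x in lebesgue. x \<notin> cube c r - box (c - r *\<^sub>R One) (c + r *\<^sub>R One)"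
    unfolding negligible_iff_null_sets by (rule AE_not_in)
  then show ?thesis
  proof (rule AE_mp, intro AE_I2 impI)
    fix x assume x: "x \<notin> cube c r - box (c - r *\<^sub>R One) (c + r *\<^sub>R One)"
    show "(\<lambda>k. cube_cutoff c r k x) \<longlonglongrightarrow> indicator (cube c r) x"
    proof (cases "x \<in> cube c r")
      case True
      with x have "\<bar>(x - c) \<bullet> b\<bar> < r" if "b \<in> Basis" for b
        using that unfolding Diff_iff mem_box by (auto simp: inner_diff_left inner_add_left abs_less_iff)
      then show ?thesis
        using True cube_cutoff_tendsto_inside[of x c r] by simp
    qed (simp add: cube_cutoff_tendsto_outside assms)
  qed
qed

lemma nn_integral_even_le:
  fixes f :: "real \<Rightarrow> real"
  assumes [measurable]: "f \<in> borel_measurable borel" and "\<And>x. f (- x) = f x"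
  shows "(\<integral>\<^sup>+x. ennreal (f x) \<partial>lborel) \<le> 2 * (\<integral>\<^sup>+x. ennreal (f x) * indicator {0..} x \<partial>lborel)"
proof -
  let ?g = "\<lambda>x. ennreal (f x) * indicator {0..} x"
  have "(\<integral>\<^sup>+x. ennreal (f x) \<partial>lborel) \<le> (\<integral>\<^sup>+x. ?g x + ?g (0 + (-1) * x) \<partial>lborel)"
    by (intro nn_integral_mono) (auto simp: indicator_def assms(2))
  also have "\<dots> = (\<integral>\<^sup>+x. ?g x \<partial>lborel) + (\<integral>\<^sup>+x. ?g (0 + (-1) * x) \<partial>lborel)"
    by (intro nn_integral_add) measurable
  also have "(\<integral>\<^sup>+x. ?g (0 + (-1) * x) \<partial>lborel) = (\<integral>\<^sup>+x. ?g x \<partial>lborel)"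
    by (subst (2) nn_integral_real_affine[where c = "-1" and t = 0]) auto
  finally show ?thesis by (simp add: mult_2)
qed

lemma tendsto_exp_minus_pow: "k > 0 \<Longrightarrow> ((\<lambda>x::real. exp (- (x ^ k))) \<longlongrightarrow> 0) at_top"
  by (rule filterlim_compose[OF exp_at_bot])
     (simp add: filterlim_uminus_at_bot filterlim_pow_at_top filterlim_ident)

text \<open>
  The majorant \<open>exp (1 - \<bar>s\<bar>)\<close> of \<open>exp (- s\<^sup>2\<^sup>k)\<close>, \<open>k > 0\<close>, does not depend on \<open>k\<close> and has integral \<open>2 exp 1\<close>.
\<close>

lemma nn_integral_exp_minus_pow_le:
  assumes "k > 0"
  shows "(\<integral>\<^sup>+s. ennreal (exp (- ((s::real) ^ (2 * k)))) \<partial>lborel) \<le> ennreal (2 * exp 1)"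
proof -
  have le: "exp (- (s ^ (2 * k))) \<le> exp (1 - \<bar>s\<bar>)" for s :: real
  proof (cases "\<bar>s\<bar> \<le> 1")
    case False
    then have "\<bar>s\<bar> ^ 1 \<le> \<bar>s\<bar> ^ (2 * k)" using assms by (intro power_increasing) auto
    moreover have "\<bar>s\<bar> ^ (2 * k) = s ^ (2 * k)" by (rule power_even_abs) simp
    ultimately show ?thesis by simp
  next
    case True
    have "0 \<le> s ^ (2 * k)" by simp
    then show ?thesis using True by (simp only: exp_le_cancel_iff)
  qed
  have half: "(\<integral>\<^sup>+s. ennreal (exp (1 - s)) * indicator {0..} s \<partial>lborel) = ennreal (0 - (- exp (1 - 0)))"
  proof (rule nn_integral_FTC_atLeast)
    have "filterlim (\<lambda>s::real. -1 + s) at_top at_top"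
      by (rule filterlim_tendsto_add_at_top[OF tendsto_const filterlim_ident])
    then have "filterlim (\<lambda>s::real. 1 - s) at_bot at_top"
      by (simp add: filterlim_uminus_at_bot)
    then have "((\<lambda>s::real. - exp (1 - s)) \<longlongrightarrow> - 0) at_top"
      by (intro tendsto_minus filterlim_compose[OF exp_at_bot])
    then show "((\<lambda>s::real. - exp (1 - s)) \<longlongrightarrow> 0) at_top" by simp
  qed (auto intro!: derivative_eq_intros)
  have "(\<integral>\<^sup>+s. ennreal (exp (- (s ^ (2 * k)))) \<partial>lborel) \<le> (\<integral>\<^sup>+s. ennreal (exp (1 - \<bar>s\<bar>)) \<partial>lborel)"
    using le by (intro nn_integral_mono ennreal_leI)
  also have "\<dots> \<le> 2 * (\<integral>\<^sup>+s. ennreal (exp (1 - \<bar>s\<bar>)) * indicator {0..} s \<partial>lborel)"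
    by (intro nn_integral_even_le) auto
  also have "(\<integral>\<^sup>+s. ennreal (exp (1 - \<bar>s\<bar>)) * indicator {0..} s \<partial>lborel) = ennreal (exp 1)"
    unfolding half[simplified, symmetric]
    by (intro nn_integral_cong) (auto simp: indicator_def)
  finally show ?thesis by (simp add: ennreal_mult')
qed

text \<open>
  The function \<open>exp (- s\<^sup>2\<^sup>k)\<close> rises from \<open>0\<close> to \<open>1\<close> and falls back to \<open>0\<close>, so its total variation
  is \<open>2\<close> for every positive \<open>k\<close>.
\<close>

lemma nn_integral_derivative_exp_minus_pow_le:
  assumes "k > 0"
  shows "(\<integral>\<^sup>+s. ennreal (2 * real k * \<bar>s::real\<bar> ^ (2 * k - 1) * exp (- (s ^ (2 * k)))) \<partial>lborel) \<le> 2"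
proof -
  have half: "(\<integral>\<^sup>+s. ennreal (2 * real k * s ^ (2 * k - 1) * exp (- (s ^ (2 * k)))) * indicator {0..} s \<partial>lborel)
      = ennreal (0 - (- exp (- (0 ^ (2 * k)))))"
  proof (rule nn_integral_FTC_atLeast)
    show "((\<lambda>s::real. - exp (- (s ^ (2 * k)))) \<longlongrightarrow> 0) at_top"
      using tendsto_minus[OF tendsto_exp_minus_pow[of "2 * k"]] assms by simp
    show "DERIV (\<lambda>s. - exp (- (s ^ (2 * k)))) s :> 2 * real k * s ^ (2 * k - 1) * exp (- (s ^ (2 * k)))" for s
      by (rule derivative_eq_intros refl)+ (simp add: mult_ac)
  qed auto
  have "(\<integral>\<^sup>+s. ennreal (2 * real k * \<bar>s::real\<bar> ^ (2 * k - 1) * exp (- (s ^ (2 * k)))) \<partial>lborel)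
      \<le> 2 * (\<integral>\<^sup>+s. ennreal (2 * real k * \<bar>s::real\<bar> ^ (2 * k - 1) * exp (- (s ^ (2 * k)))) * indicator {0..} s \<partial>lborel)"
    by (intro nn_integral_even_le) auto
  also have "(\<integral>\<^sup>+s. ennreal (2 * real k * \<bar>s::real\<bar> ^ (2 * k - 1) * exp (- (s ^ (2 * k)))) * indicator {0..} s \<partial>lborel)
      = (\<integral>\<^sup>+s. ennreal (2 * real k * s ^ (2 * k - 1) * exp (- (s ^ (2 * k)))) * indicator {0..} s \<partial>lborel)"
    by (intro nn_integral_cong) (auto simp: indicator_def)
  also have "\<dots> = 1" unfolding half using assms by (simp add: power_0_left)
  finally show ?thesis by simp
qed

text \<open>
  An upper bound, uniform in \<open>k\<close>, for the integral of \<open>cube_cutoff_slope c r k\<close>, and hence for the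
  perimeter of a cube. It is of order \<open>r\<^sup>n\<close> with \<open>n = DIM('a) - 1\<close>, so in dimension at least two it
  tends to zero with \<open>r\<close>.
\<close>

definition cube_cost :: "'a::euclidean_space itself \<Rightarrow> real \<Rightarrow> real" where
  "cube_cost _ r = 2 * real DIM('a) * (2 * exp 1 * r) ^ (DIM('a) - 1)"

lemma prod_mono_ennreal:
  fixes f g :: "'i \<Rightarrow> ennreal"
  assumes "\<And>i. i \<in> I \<Longrightarrow> f i \<le> g i"
  shows "prod f I \<le> prod g I"
  using assms by (induction I rule: infinite_finite_induct) (auto intro!: mult_mono)

text \<open>
  By Fubini the summand with the derivative in the direction \<open>b\<close> is a product of one-dimensional integrals:
  the factor for \<open>b\<close> is a total variation, which is at most \<open>2\<close> at every scale, and each of the other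
  \<open>DIM('a) - 1\<close> factors is at most \<open>2 exp 1 * r\<close>.
\<close>

lemma nn_integral_cube_cutoff_slope_le:
  fixes c :: "'a::euclidean_space"
  assumes "r > 0" "k > 0"
  shows "(\<integral>\<^sup>+x. ennreal (cube_cutoff_slope c r k x) \<partial>lborel) \<le> ennreal (cube_cost TYPE('a) r)"
proof -
  define q where "q = (\<lambda>s::real. exp (- (s ^ (2 * k))))"
  define p where "p = (\<lambda>s::real. 2 * real k * \<bar>s\<bar> ^ (2 * k - 1) * q s)"
  define F where "F = (\<lambda>b b' s. ennreal (if b' = b then p ((s - c \<bullet> b') / r) / r else q ((s - c \<bullet> b') / r)))"
  have [measurable]: "q \<in> borel_measurable borel" "p \<in> borel_measurable borel"
    by (auto simp: q_def p_def)
  have nonneg: "0 \<le> q s" "0 \<le> p s" for s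
    by (auto simp: q_def p_def)
  have F_meas [measurable]: "F b b' \<in> borel_measurable borel" for b b'
    unfolding F_def by measurable
  have slope: "ennreal (cube_cutoff_slope c r k x) = (\<Sum>b\<in>Basis. \<Prod>b'\<in>Basis. F b b' (x \<bullet> b'))" for x
  proof -
    let ?u = "\<lambda>b. (x \<bullet> b - c \<bullet> b) / r"
    have cut: "cube_cutoff c r k x = (\<Prod>b\<in>Basis. q (?u b))"
      by (simp add: cube_cutoff_def q_def exp_sum sum_negf[symmetric] inner_diff_left del: sum_negf)
    have "cube_cutoff_slope c r k x =
        (\<Sum>b\<in>Basis. (2 * real k / r) * \<bar>?u b\<bar> ^ (2 * k - 1) * (\<Prod>b'\<in>Basis. q (?u b')))"
      by (simp add: cube_cutoff_slope_def cut sum_distrib_left mult_ac inner_diff_left)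
    also have "\<dots> = (\<Sum>b\<in>Basis. \<Prod>b'\<in>Basis. if b' = b then p (?u b') / r else q (?u b'))"
    proof (rule sum.cong[OF refl])
      fix b :: 'a assume b: "b \<in> Basis"
      have "(\<Prod>b'\<in>Basis. if b' = b then p (?u b') / r else q (?u b'))
          = (p (?u b) / r) * (\<Prod>b'\<in>Basis - {b}. q (?u b'))"
        using b by (subst prod.remove[OF _ b]) (auto intro!: prod.cong)
      moreover have "(\<Prod>b'\<in>Basis. q (?u b')) = q (?u b) * (\<Prod>b'\<in>Basis - {b}. q (?u b'))"
        using b by (subst prod.remove[OF _ b]) auto
      ultimately show "(2 * real k / r) * \<bar>?u b\<bar> ^ (2 * k - 1) * (\<Prod>b'\<in>Basis. q (?u b'))
          = (\<Prod>b'\<in>Basis. if b' = b then p (?u b') / r else q (?u b'))"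
        by (simp add: p_def)
    qed
    also have "ennreal \<dots> = (\<Sum>b\<in>Basis. \<Prod>b'\<in>Basis. F b b' (x \<bullet> b'))"
      unfolding F_def using nonneg assms
      by (subst sum_ennreal[symmetric] prod_ennreal[symmetric]; (intro prod_nonneg sum_nonneg)?; auto)+
    finally show ?thesis .
  qed
  have int_p: "(\<integral>\<^sup>+s. F b b s \<partial>lborel) \<le> ennreal 2" for b
  proof -
    have "(\<integral>\<^sup>+s. F b b s \<partial>lborel) = ennreal \<bar>r\<bar> * (\<integral>\<^sup>+s. F b b (c \<bullet> b + r * s) \<partial>lborel)"
      using assms by (intro nn_integral_real_affine) auto
    also have "\<dots> = (\<integral>\<^sup>+s. ennreal \<bar>r\<bar> * F b b (c \<bullet> b + r * s) \<partial>lborel)"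
      by (intro nn_integral_cmult[symmetric]) measurable
    also have "\<dots> = (\<integral>\<^sup>+s. ennreal (p s) \<partial>lborel)"
      using assms nonneg by (intro nn_integral_cong) (simp add: F_def ennreal_mult[symmetric])
    also have "\<dots> \<le> 2"
      using nn_integral_derivative_exp_minus_pow_le[OF assms(2)] by (simp add: p_def q_def)
    finally show ?thesis by simp
  qed
  have int_q: "(\<integral>\<^sup>+s. F b b' s \<partial>lborel) \<le> ennreal (2 * exp 1 * r)" if "b' \<noteq> b" for b b'
  proof -
    have "(\<integral>\<^sup>+s. F b b' s \<partial>lborel) = ennreal \<bar>r\<bar> * (\<integral>\<^sup>+s. F b b' (c \<bullet> b' + r * s) \<partial>lborel)"
      using assms by (intro nn_integral_real_affine) auto
    also have "\<dots> = ennreal r * (\<integral>\<^sup>+s. ennreal (q s) \<partial>lborel)"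
      using assms that by (simp add: F_def)
    also have "\<dots> \<le> ennreal r * ennreal (2 * exp 1)"
      using nn_integral_exp_minus_pow_le[OF assms(2)] by (intro mult_left_mono) (auto simp: q_def)
    finally show ?thesis using assms by (simp add: ennreal_mult[symmetric] mult_ac)
  qed
  have "(\<integral>\<^sup>+x. ennreal (cube_cutoff_slope c r k x) \<partial>lborel)
      = (\<Sum>b\<in>Basis. \<integral>\<^sup>+x. (\<Prod>b'\<in>Basis. F b b' (x \<bullet> b')) \<partial>lborel)"
    unfolding slope by (intro nn_integral_sum) measurable
  also have "\<dots> = (\<Sum>b\<in>Basis. \<Prod>b'\<in>Basis. \<integral>\<^sup>+s. F b b' s \<partial>lborel)"
    by (intro sum.cong refl nn_integral_lborel_prod) auto
  also have "\<dots> \<le> (\<Sum>b\<in>(Basis::'a set). ennreal (2 * (2 * exp 1 * r) ^ (DIM('a) - 1)))"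
  proof (rule sum_mono)
    fix b :: 'a assume b: "b \<in> Basis"
    have "(\<Prod>b'\<in>Basis. \<integral>\<^sup>+s. F b b' s \<partial>lborel)
        = (\<integral>\<^sup>+s. F b b s \<partial>lborel) * (\<Prod>b'\<in>Basis - {b}. \<integral>\<^sup>+s. F b b' s \<partial>lborel)"
      using b by (intro prod.remove) auto
    also have "\<dots> \<le> ennreal 2 * (\<Prod>b'\<in>Basis - {b}. ennreal (2 * exp 1 * r))"
      using int_p int_q by (intro mult_mono prod_mono_ennreal) auto
    also have "\<dots> = ennreal (2 * (2 * exp 1 * r) ^ (DIM('a) - 1))"
      using assms b by (simp add: ennreal_mult' ennreal_power[symmetric] card_Diff_singleton)
    finally show "(\<Prod>b'\<in>Basis. \<integral>\<^sup>+s. F b b' s \<partial>lborel) \<le> ennreal (2 * (2 * exp 1 * r) ^ (DIM('a) - 1))" .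
  qed
  also have "\<dots> = ennreal (cube_cost TYPE('a) r)"
    using assms by (subst sum_ennreal) (auto simp: cube_cost_def)
  finally show ?thesis .
qed

section \<open>The perimeter of a set after adding or removing a cube\<close>

lemma test_fieldsD:
  assumes "\<xi> \<in> test_fields C"
  shows "smooth \<xi>" "compact (closure {x. \<xi> x \<noteq> 0})" "closure {x. \<xi> x \<noteq> 0} \<subseteq> interior C"
    "norm (\<xi> x) \<le> 1"
  using assms by (auto simp: test_fields_def)

lemma zero_test_field: "(\<lambda>x. 0) \<in> test_fields C"
  by (simp add: test_fields_def smooth_const)

lemma test_fields_scaleR:
  assumes "\<xi> \<in> test_fields C" "smooth \<psi>" "\<And>x. \<bar>\<psi> x\<bar> \<le> 1"
  shows "(\<lambda>x. \<psi> x *\<^sub>R \<xi> x) \<in> test_fields C"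
proof -
  note \<xi> = test_fieldsD[OF assms(1)]
  have sub: "closure {x. \<psi> x *\<^sub>R \<xi> x \<noteq> 0} \<subseteq> closure {x. \<xi> x \<noteq> 0}"
    by (intro closure_mono) auto
  have "compact (closure {x. \<psi> x *\<^sub>R \<xi> x \<noteq> 0})"
    using sub \<xi>(2) by (meson closed_closure compact_eq_bounded_closed bounded_subset)
  moreover have "norm (\<psi> x *\<^sub>R \<xi> x) \<le> 1" for x
    using mult_le_one[of "\<bar>\<psi> x\<bar>" "norm (\<xi> x)"] assms(3)[of x] \<xi>(4)[of x] by simp
  ultimately show ?thesis
    using sub \<xi> assms(2) by (auto simp: test_fields_def intro: smooth_scaleR)
qed

lemma divergence_test_field:
  assumes "\<xi> \<in> test_fields C"
  shows "integrable lebesgue (divergence \<xi>)"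
    "A \<in> sets lebesgue \<Longrightarrow> set_integrable lebesgue A (divergence \<xi>)"
    "x \<notin> interior C \<Longrightarrow> divergence \<xi> x = 0"
proof -
  note \<xi> = test_fieldsD[OF assms]
  show int: "integrable lebesgue (divergence \<xi>)"
    using \<xi> by (intro integrable_divergence)
  show "set_integrable lebesgue A (divergence \<xi>)" if "A \<in> sets lebesgue"
    unfolding set_integrable_def using that int by (rule integrable_mult_indicator)
  show "divergence \<xi> x = 0" if "x \<notin> interior C"
    using \<xi>(3) that by (intro divergence_outside_support) auto
qed

lemma integral_le_rel_perimeter:
  "\<xi> \<in> test_fields C \<Longrightarrow> ereal (LINT x:E|lebesgue. divergence \<xi> x) \<le> rel_perimeter C E"
  unfolding rel_perimeter_def by (rule SUP_upper)

lemma rel_perimeter_leI: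
  "(\<And>\<xi>. \<xi> \<in> test_fields C \<Longrightarrow> ereal (LINT x:E|lebesgue. divergence \<xi> x) \<le> p) \<Longrightarrow> rel_perimeter C E \<le> p"
  unfolding rel_perimeter_def by (rule SUP_least)

lemma rel_perimeter_nonneg: "0 \<le> rel_perimeter C E"
  using integral_le_rel_perimeter[OF zero_test_field, of E C]
  by (simp add: divergence_def set_lebesgue_integral_def zero_ereal_def)

lemma rel_perimeter_empty: "rel_perimeter C {} = 0"
  by (intro antisym rel_perimeter_nonneg rel_perimeter_leI) (simp add: set_lebesgue_integral_def)

lemma integral_cutoff_tendsto:
  fixes \<xi> :: "'a::euclidean_space \<Rightarrow> 'a"
  assumes "\<xi> \<in> test_fields C" "r > 0" "A \<in> sets lebesgue"
  shows "(\<lambda>k. LINT x:A|lebesgue. cube_cutoff c r k x * divergence \<xi> x)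
    \<longlonglongrightarrow> (LINT x:A \<inter> cube c r|lebesgue. divergence \<xi> x)"
    "set_integrable lebesgue A (\<lambda>x. cube_cutoff c r k x * divergence \<xi> x)"
proof -
  note \<xi> = test_fieldsD[OF assms(1)]
  have meas: "(\<lambda>x. indicator A x *\<^sub>R (cube_cutoff c r k x * divergence \<xi> x)) \<in> borel_measurable lebesgue" for k
  proof -
    have "continuous_on UNIV (\<lambda>x. cube_cutoff c r k x * divergence \<xi> x)"
      by (intro continuous_intros continuous_on_smooth smooth_cube_cutoff continuous_on_divergence \<xi>)
    then have "(\<lambda>x. cube_cutoff c r k x * divergence \<xi> x) \<in> borel_measurable lebesgue"
      by (intro measurable_completion) (simp add: borel_measurable_continuous_onI)
    then show ?thesis using assms(3) by (intro borel_measurable_scaleR borel_measurable_indicator)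
  qed
  have bound: "norm (indicator A x *\<^sub>R (cube_cutoff c r k x * divergence \<xi> x)) \<le> \<bar>divergence \<xi> x\<bar>" for k x
    using cube_cutoff_bounds[of c r k x]
    by (auto simp: indicator_def abs_mult intro!: mult_left_le_one_le)
  have dom: "integrable lebesgue (\<lambda>x. \<bar>divergence \<xi> x\<bar>)"
    using divergence_test_field(1)[OF assms(1)] by (rule integrable_abs)
  show "set_integrable lebesgue A (\<lambda>x. cube_cutoff c r k x * divergence \<xi> x)"
    unfolding set_integrable_def
    by (rule Bochner_Integration.integrable_bound[OF dom meas]) (use bound in auto)
  show "(\<lambda>k. LINT x:A|lebesgue. cube_cutoff c r k x * divergence \<xi> x)
    \<longlonglongrightarrow> (LINT x:A \<inter> cube c r|lebesgue. divergence \<xi> x)"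
    unfolding set_lebesgue_integral_def
  proof (rule integral_dominated_convergence[OF _ meas dom])
    show "(\<lambda>x. indicator (A \<inter> cube c r) x *\<^sub>R divergence \<xi> x) \<in> borel_measurable lebesgue"
      using divergence_test_field(2)[OF assms(1), of "A \<inter> cube c r"] assms(3)
      by (auto simp: set_integrable_def)
    show "AE x in lebesgue. (\<lambda>k. indicator A x *\<^sub>R (cube_cutoff c r k x * divergence \<xi> x))
        \<longlonglongrightarrow> indicator (A \<inter> cube c r) x *\<^sub>R divergence \<xi> x"
      using AE_cube_cutoff_tendsto[OF assms(2), of c]
    proof eventually_elim
      case (elim x)
      have "(\<lambda>k. indicator A x *\<^sub>R (cube_cutoff c r k x * divergence \<xi> x))
          \<longlonglongrightarrow> indicator A x *\<^sub>R (indicator (cube c r) x * divergence \<xi> x)"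
        by (intro tendsto_intros elim)
      then show ?case by (simp add: indicator_inter_arith mult.assoc)
    qed
  qed (use bound in auto)
qed

text \<open>
  The error term of the product rule for \<open>cube_cutoff c r k *\<^sub>R \<xi>\<close> is controlled independently of \<open>k\<close>
  and of the test field.
\<close>

lemma integral_cutoff_derivative_le:
  fixes \<xi> :: "'a::euclidean_space \<Rightarrow> 'a" and c :: 'a
  assumes "\<xi> \<in> test_fields C" "r > 0" "k > 0" "A \<in> sets lebesgue"
  defines "g \<equiv> \<lambda>x. frechet_derivative (cube_cutoff c r k) (at x) (\<xi> x)"
  shows "set_integrable lebesgue A g" "\<bar>LINT x:A|lebesgue. g x\<bar> \<le> cube_cost TYPE('a) r"
proof -
  note \<xi> = test_fieldsD[OF assms(1)]
  let ?\<psi> = "\<lambda>x. cube_cutoff c r k x *\<^sub>R \<xi> x"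
  have "?\<psi> \<in> test_fields C"
    by (intro test_fields_scaleR assms(1) smooth_cube_cutoff abs_cube_cutoff_le_1)
  then have "integrable lebesgue (divergence ?\<psi>)"
    by (rule divergence_test_field)
  moreover have "integrable lebesgue (\<lambda>x. cube_cutoff c r k x * divergence \<xi> x)"
    using integral_cutoff_tendsto(2)[OF assms(1,2), of UNIV c k] by (simp add: set_integrable_def)
  ultimately have "integrable lebesgue (\<lambda>x. divergence ?\<psi> x - cube_cutoff c r k x * divergence \<xi> x)"
    by (rule Bochner_Integration.integrable_diff)
  then have int: "integrable lebesgue g"
    by (simp add: divergence_scaleR[OF smooth_cube_cutoff \<xi>(1)] g_def)
  then show set_int: "set_integrable lebesgue A g"
    unfolding set_integrable_def using assms(4) by (intro integrable_mult_indicator)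
  have "ennreal \<bar>LINT x:A|lebesgue. g x\<bar> \<le> (\<integral>\<^sup>+x. norm (indicator A x *\<^sub>R g x) \<partial>lebesgue)"
    using integral_norm_bound_ennreal[OF set_int[unfolded set_integrable_def]]
    by (simp add: set_lebesgue_integral_def)
  also have "\<dots> \<le> (\<integral>\<^sup>+x. ennreal (cube_cutoff_slope c r k x) \<partial>lebesgue)"
  proof (intro nn_integral_mono ennreal_leI)
    fix x
    have "norm (indicator A x *\<^sub>R g x) \<le> \<bar>g x\<bar>" by (auto simp: indicator_def)
    also have "\<dots> \<le> cube_cutoff_slope c r k x"
      unfolding g_def by (rule abs_derivative_cube_cutoff_le[OF \<xi>(4) assms(2)])
    finally show "norm (indicator A x *\<^sub>R g x) \<le> cube_cutoff_slope c r k x" .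
  qed
  also have "\<dots> \<le> ennreal (cube_cost TYPE('a) r)"
    using nn_integral_cube_cutoff_slope_le[OF assms(2,3), of c] by (simp add: nn_integral_completion)
  finally show "\<bar>LINT x:A|lebesgue. g x\<bar> \<le> cube_cost TYPE('a) r"
    using assms(2) by (simp add: cube_cost_def)
qed

text \<open>
  Multiplying a test field by \<open>1 - \<phi>\<^sub>k\<close>, where \<open>\<phi>\<^sub>k\<close> is the cutoff function of the cube, gives
  another test field; testing \<open>E\<close> with it costs the integral of the gradient of \<open>\<phi>\<^sub>k\<close>, and in the
  limit it tests \<open>E - cube c r\<close> with the original field.
\<close>

lemma integral_diff_cube_le:
  fixes \<xi> :: "'a::euclidean_space \<Rightarrow> 'a"
  assumes "\<xi> \<in> test_fields C" "r > 0" "E \<in> sets lebesgue"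
  shows "ereal (LINT x:E - cube c r|lebesgue. divergence \<xi> x) \<le> rel_perimeter C E + ereal (cube_cost TYPE('a) r)"
proof -
  note \<xi> = test_fieldsD[OF assms(1)]
  let ?w = "divergence \<xi>"
  let ?\<phi> = "cube_cutoff c r"
  have "E = (E - cube c r) \<union> (E \<inter> cube c r)" by blast
  then have split: "(LINT x:E|lebesgue. ?w x)
      = (LINT x:E - cube c r|lebesgue. ?w x) + (LINT x:E \<inter> cube c r|lebesgue. ?w x)"
    using divergence_test_field(2)[OF assms(1)] assms(3)
    by (metis (no_types, lifting) Diff_Int_distrib Diff_disjoint Int_commute Int_assoc cube_lebesgue(1)
        inf_bot_right sets.Diff sets.Int set_integral_Un)
  have "(\<lambda>k. (LINT x:E|lebesgue. ?w x) - (LINT x:E|lebesgue. ?\<phi> k x * ?w x))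
      \<longlonglongrightarrow> (LINT x:E|lebesgue. ?w x) - (LINT x:E \<inter> cube c r|lebesgue. ?w x)"
    by (intro tendsto_diff tendsto_const integral_cutoff_tendsto(1)[OF assms])
  then have lim: "(\<lambda>k. ereal ((LINT x:E|lebesgue. ?w x) - (LINT x:E|lebesgue. ?\<phi> k x * ?w x)))
      \<longlonglongrightarrow> ereal (LINT x:E - cube c r|lebesgue. ?w x)"
    by (simp add: split)
  show ?thesis
  proof (rule Lim_bounded[OF lim], intro allI impI)
    fix k :: nat assume "1 \<le> k"
    then have k: "k > 0" by simp
    let ?\<psi> = "\<lambda>x. (1 - ?\<phi> k x) *\<^sub>R \<xi> x"
    have sm: "smooth (\<lambda>x. 1 - ?\<phi> k x)"
      by (intro smooth_diff smooth_const smooth_cube_cutoff)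
    have test: "?\<psi> \<in> test_fields C"
      by (intro test_fields_scaleR assms(1) sm abs_cube_cutoff_le_1)
    have "((\<lambda>x. 1 - ?\<phi> k x) has_derivative (\<lambda>v. 0 - frechet_derivative (?\<phi> k) (at x) v)) (at x)" for x
      by (intro has_derivative_diff has_derivative_const smooth_has_derivative smooth_cube_cutoff)
    then have D: "frechet_derivative (\<lambda>x. 1 - ?\<phi> k x) (at x) = (\<lambda>v. - frechet_derivative (?\<phi> k) (at x) v)" for x
      by (metis (no_types, lifting) diff_0 frechet_derivative_at)
    note g = integral_cutoff_derivative_le[OF assms(1,2) k assms(3), of c]
    have "(LINT x:E|lebesgue. ?w x) - (LINT x:E|lebesgue. ?\<phi> k x * ?w x)
        = (LINT x:E|lebesgue. ?w x - ?\<phi> k x * ?w x)"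
      using assms by (intro set_integral_diff(2)[symmetric] divergence_test_field integral_cutoff_tendsto)
    also have "\<dots> = (LINT x:E|lebesgue. divergence ?\<psi> x + frechet_derivative (?\<phi> k) (at x) (\<xi> x))"
      by (simp add: divergence_scaleR[OF sm \<xi>(1)] D left_diff_distrib)
    also have "\<dots> = (LINT x:E|lebesgue. divergence ?\<psi> x)
        + (LINT x:E|lebesgue. frechet_derivative (?\<phi> k) (at x) (\<xi> x))"
      by (intro set_integral_add(2) divergence_test_field(2)[OF test] assms g)
    also have "ereal \<dots> \<le> rel_perimeter C E + ereal (cube_cost TYPE('a) r)"
      using integral_le_rel_perimeter[OF test, of E] g(2)
      unfolding plus_ereal.simps(1)[symmetric] by (intro add_mono) auto
    finally show "ereal ((LINT x:E|lebesgue. ?w x) - (LINT x:E|lebesgue. ?\<phi> k x * ?w x))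
        \<le> rel_perimeter C E + ereal (cube_cost TYPE('a) r)" .
  qed
qed

text \<open>
  The same argument with \<open>\<phi>\<^sub>k\<close> in place of \<open>1 - \<phi>\<^sub>k\<close> and the whole space in place of \<open>E\<close>, whose perimeter
  is zero by the divergence theorem.
\<close>

lemma integral_cube_le:
  fixes \<xi> :: "'a::euclidean_space \<Rightarrow> 'a"
  assumes "\<xi> \<in> test_fields C" "r > 0"
  shows "(LINT x:cube c r|lebesgue. divergence \<xi> x) \<le> cube_cost TYPE('a) r"
proof -
  note \<xi> = test_fieldsD[OF assms(1)]
  let ?w = "divergence \<xi>"
  let ?\<phi> = "cube_cutoff c r"
  have lim: "(\<lambda>k. LINT x:UNIV|lebesgue. ?\<phi> k x * ?w x) \<longlonglongrightarrow> (LINT x:cube c r|lebesgue. ?w x)"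
    using integral_cutoff_tendsto(1)[OF assms, of UNIV c] by simp
  show ?thesis
  proof (rule Lim_bounded[OF lim], intro allI impI)
    fix k :: nat assume "1 \<le> k"
    then have k: "k > 0" by simp
    let ?\<psi> = "\<lambda>x. ?\<phi> k x *\<^sub>R \<xi> x"
    have test: "?\<psi> \<in> test_fields C"
      by (intro test_fields_scaleR assms(1) smooth_cube_cutoff abs_cube_cutoff_le_1)
    note g = integral_cutoff_derivative_le[OF assms k, of UNIV c]
    have "(LINT x:UNIV|lebesgue. ?\<phi> k x * ?w x)
        = (LINT x:UNIV|lebesgue. divergence ?\<psi> x - frechet_derivative (?\<phi> k) (at x) (\<xi> x))"
      using divergence_scaleR[OF smooth_cube_cutoff \<xi>(1)] by simp
    also have "\<dots> = (LINT x:UNIV|lebesgue. divergence ?\<psi> x)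
        - (LINT x:UNIV|lebesgue. frechet_derivative (?\<phi> k) (at x) (\<xi> x))"
      by (intro set_integral_diff(2) divergence_test_field(2)[OF test] g) auto
    also have "(LINT x:UNIV|lebesgue. divergence ?\<psi> x) = 0"
      using integral_divergence_eq_0[OF test_fieldsD(1,2)[OF test]] by (simp add: set_lebesgue_integral_def)
    also have "0 - (LINT x:UNIV|lebesgue. frechet_derivative (?\<phi> k) (at x) (\<xi> x)) \<le> cube_cost TYPE('a) r"
      using g(2) by auto
    finally show "(LINT x:UNIV|lebesgue. ?\<phi> k x * ?w x) \<le> cube_cost TYPE('a) r" .
  qed
qed

lemma rel_perimeter_diff_cube_le:
  fixes C :: "'a::euclidean_space set"
  assumes "r > 0" "E \<in> sets lebesgue"
  shows "rel_perimeter C (E - cube c r) \<le> rel_perimeter C E + ereal (cube_cost TYPE('a) r)"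
  using integral_diff_cube_le[OF _ assms] by (intro rel_perimeter_leI)

text \<open>
  The union is the disjoint union of \<open>E - cube c r\<close> and \<open>cube c r \<inter> C\<close>, and each part adds at
  most \<open>cube_cost\<close> to the perimeter of \<open>E\<close>; hence the factor \<open>2\<close>.
\<close>

lemma rel_perimeter_Un_cube_le:
  fixes C :: "'a::euclidean_space set"
  assumes "r > 0" "E \<in> sets lebesgue" "C \<in> sets lebesgue" "E \<subseteq> C"
  shows "rel_perimeter C (E \<union> cube c r \<inter> C) \<le> rel_perimeter C E + ereal (2 * cube_cost TYPE('a) r)"
proof (rule rel_perimeter_leI)
  fix \<xi> assume \<xi>: "\<xi> \<in> test_fields C"
  let ?w = "divergence \<xi>"
  have "E \<union> cube c r \<inter> C = (E - cube c r) \<union> (cube c r \<inter> C)"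
    using assms(4) by blast
  then have "(LINT x:E \<union> cube c r \<inter> C|lebesgue. ?w x)
      = (LINT x:E - cube c r|lebesgue. ?w x) + (LINT x:cube c r \<inter> C|lebesgue. ?w x)"
    using assms by (simp only:) (intro set_integral_Un divergence_test_field(2)[OF \<xi>]; auto)
  also have "(LINT x:cube c r \<inter> C|lebesgue. ?w x) = (LINT x:cube c r|lebesgue. ?w x)"
    unfolding set_lebesgue_integral_def
    using divergence_test_field(3)[OF \<xi>] interior_subset[of C]
    by (intro Bochner_Integration.integral_cong) (auto simp: indicator_def)
  also have "ereal ((LINT x:E - cube c r|lebesgue. ?w x) + \<dots>)
      \<le> (rel_perimeter C E + ereal (cube_cost TYPE('a) r)) + ereal (cube_cost TYPE('a) r)"
    unfolding plus_ereal.simps(1)[symmetric]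
    using integral_diff_cube_le[OF \<xi> assms(1,2), of c] integral_cube_le[OF \<xi> assms(1), of c]
    by (intro add_mono) auto
  also have "\<dots> = rel_perimeter C E + ereal (2 * cube_cost TYPE('a) r)"
    by (simp add: add.assoc)
  finally show "ereal (LINT x:E \<union> cube c r \<inter> C|lebesgue. ?w x)
      \<le> rel_perimeter C E + ereal (2 * cube_cost TYPE('a) r)" .
qed

section \<open>Adjusting the volume of a set at a small cost in perimeter\<close>

lemma measure_cube:
  fixes c :: "'a::euclidean_space"
  assumes "r \<ge> 0"
  shows "measure lebesgue (cube c r) = (2 * r) ^ DIM('a)"
proof -
  have "cbox (c - r *\<^sub>R One) (c + r *\<^sub>R One) \<noteq> {}"
    using assms by (auto simp: box_ne_empty inner_diff_left inner_add_left)
  then show ?thesis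
    by (simp add: cube_def content_cbox' inner_diff_left inner_add_left)
qed

lemma cube_mono: "r \<le> r' \<Longrightarrow> cube c r \<subseteq> cube c r'"
  unfolding mem_cube subset_iff by (meson order_trans)

text \<open>
  The increments are dominated by those of the volume of the cube.
\<close>

lemma continuous_on_measure_Int_cube:
  fixes c :: "'a::euclidean_space"
  assumes S: "S \<in> lmeasurable"
  shows "continuous_on {0..} (\<lambda>r. measure lebesgue (S \<inter> cube c r))"
proof -
  define m where "m = (\<lambda>r. measure lebesgue (S \<inter> cube c r))"
  define g where "g = (\<lambda>r::real. (2 * r) ^ DIM('a))"
  have step: "\<bar>m r' - m r\<bar> \<le> \<bar>g r' - g r\<bar>" if "0 \<le> r" "r \<le> r'" for r r'
  proof -
    have "m r' - m r = measure lebesgue (S \<inter> cube c r' - S \<inter> cube c r)"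
      unfolding m_def using S cube_mono[OF that(2), of c]
      by (intro measurable_measure_Diff[symmetric] fmeasurable.Int) (auto simp: fmeasurableD)
    also have "\<dots> \<le> measure lebesgue (cube c r' - cube c r)"
      using S by (intro measure_mono_fmeasurable fmeasurable_Diff fmeasurable.Diff) (auto simp: fmeasurableD)
    also have "\<dots> = g r' - g r"
      using that cube_mono[OF that(2), of c]
      by (subst measurable_measure_Diff) (auto simp: g_def measure_cube)
    finally have "m r' - m r \<le> g r' - g r" .
    moreover have "m r \<le> m r'"
      unfolding m_def using S cube_mono[OF that(2), of c]
      by (intro measure_mono_fmeasurable fmeasurable.Int) (auto simp: fmeasurableD)
    ultimately show ?thesis by simp
  qed
  have both: "\<bar>m r' - m r\<bar> \<le> \<bar>g r' - g r\<bar>" if "0 \<le> r" "0 \<le> r'" for r r'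
    using step[of r r'] step[of r' r] that by (cases "r \<le> r'") (auto simp: abs_minus_commute)
  have "continuous_on {0..} g" unfolding g_def by (intro continuous_intros)
  then show ?thesis
    unfolding m_def[symmetric] continuous_on_iff dist_real_def
    using both by (meson atLeast_iff le_less_trans)
qed

lemma exists_cube_with_measure:
  fixes c :: "'a::euclidean_space"
  assumes "S \<in> lmeasurable" "0 < s" "s \<le> measure lebesgue (S \<inter> cube c R)" "R > 0"
  obtains r where "0 < r" "r \<le> R" "measure lebesgue (S \<inter> cube c r) = s"
proof -
  let ?m = "\<lambda>r. measure lebesgue (S \<inter> cube c r)"
  have "?m 0 \<le> measure lebesgue (cube c 0)"
    using assms(1) by (intro measure_mono_fmeasurable) (auto simp: fmeasurableD)
  then have m0: "?m 0 = 0"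
    using measure_nonneg[of lebesgue "S \<inter> cube c 0"] by (simp add: measure_cube power_0_left)
  have "continuous_on {0..R} ?m"
    using continuous_on_measure_Int_cube[OF assms(1)] by (rule continuous_on_subset) auto
  then obtain r where "0 \<le> r" "r \<le> R" "?m r = s"
    using IVT'[of ?m 0 s R] assms(2,3,4) unfolding m0 by (metis less_imp_le)
  moreover have "r \<noteq> 0" using \<open>?m r = s\<close> m0 assms(2) by (metis less_irrefl)
  ultimately show ?thesis by (intro that[of r]) linarith+
qed

text \<open>
  Cover \<open>K\<close> by finitely many cubes of the given size: one of them contains a fixed proportion of \<open>S\<close>. The
  point is that \<open>N\<close> depends on \<open>K\<close> and \<open>r\<close> only.
\<close>

lemma bounded_pigeonhole_cube:
  fixes K :: "'a::euclidean_space set"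
  assumes "bounded K" "r > 0"
  obtains N :: real where "N > 0"
    "\<And>S. S \<in> lmeasurable \<Longrightarrow> S \<subseteq> K \<Longrightarrow> \<exists>c. measure lebesgue S \<le> N * measure lebesgue (S \<inter> cube c r)"
proof -
  have "compact (closure K)" using assms(1) by (simp add: compact_closure)
  then obtain F where F: "finite F" "closure K \<subseteq> (\<Union>c\<in>F. ball c r)"
    using assms(2) unfolding compact_eq_totally_bounded by auto
  have ball_cube: "ball c r \<subseteq> cube c r" for c :: 'a
  proof
    fix x assume "x \<in> ball c r"
    then have "norm (x - c) < r" by (simp add: dist_norm norm_minus_commute)
    then show "x \<in> cube c r"
      using order_trans[OF Basis_le_norm[of _ "x - c"], of _ r] by (simp add: mem_cube)
  qed
  show ?thesis
  proof (rule that[of "real (card F) + 1"])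
    fix S :: "'a set" assume S: "S \<in> lmeasurable" "S \<subseteq> K"
    let ?m = "measure lebesgue S"
    show "\<exists>c. ?m \<le> (real (card F) + 1) * measure lebesgue (S \<inter> cube c r)"
    proof (rule ccontr)
      assume "\<not> ?thesis"
      then have less: "(real (card F) + 1) * measure lebesgue (S \<inter> cube c r) < ?m" for c
        by (simp add: not_le)
      have le: "measure lebesgue (S \<inter> cube c r) \<le> ?m / (real (card F) + 1)" for c
        using less[of c] by (simp add: pos_le_divide_eq mult.commute)
      have pos: "0 < ?m"
        by (rule le_less_trans[OF _ less[of undefined]]) simp
      have "S \<subseteq> (\<Union>c\<in>F. S \<inter> cube c r)"
      proof
        fix x assume "x \<in> S"
        then have "x \<in> closure K" using S(2) closure_subset by blast
        then obtain c where "c \<in> F" "x \<in> ball c r" using F(2) by blast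
        then show "x \<in> (\<Union>c\<in>F. S \<inter> cube c r)" using ball_cube[of c] \<open>x \<in> S\<close> by blast
      qed
      then have "?m \<le> measure lebesgue (\<Union>c\<in>F. S \<inter> cube c r)"
        using S F(1) by (intro measure_mono_fmeasurable fmeasurable.finite_UN fmeasurable.Int fmeasurableD) auto
      also have "\<dots> \<le> (\<Sum>c\<in>F. measure lebesgue (S \<inter> cube c r))"
        using S F(1) by (intro measure_UNION_le) (auto simp: fmeasurableD)
      also have "\<dots> \<le> real (card F) * (?m / (real (card F) + 1))"
        using le by (rule sum_bounded_above)
      also have "\<dots> < ?m" using pos by (simp add: field_simps)
      finally show False by simp
    qed
  qed simp
qed

lemma cube_cost_mono: "0 \<le> r \<Longrightarrow> r \<le> r' \<Longrightarrow> cube_cost TYPE('a::euclidean_space) r \<le> cube_cost TYPE('a) r'"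
  unfolding cube_cost_def by (intro mult_left_mono power_mono) auto

lemma cube_cost_nonneg: "0 \<le> r \<Longrightarrow> 0 \<le> cube_cost TYPE('a::euclidean_space) r"
  by (simp add: cube_cost_def)

lemma cube_cost_small:
  assumes "DIM('a::euclidean_space) \<ge> 2" "\<eta> > 0"
  obtains r where "r > 0" "2 * cube_cost TYPE('a) r \<le> \<eta>"
proof -
  have "((\<lambda>r. 2 * cube_cost TYPE('a) r) \<longlongrightarrow> 2 * cube_cost TYPE('a) 0) (at_right 0)"
    unfolding cube_cost_def by (intro tendsto_intros)
  moreover have "2 * cube_cost TYPE('a) 0 < \<eta>"
    using assms by (simp add: cube_cost_def power_0_left)
  ultimately have "\<forall>\<^sub>F r in at_right 0. 2 * cube_cost TYPE('a) r < \<eta>"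
    by (rule order_tendstoD)
  then have "\<forall>\<^sub>F r::real in at_right 0. 0 < r \<and> 2 * cube_cost TYPE('a) r < \<eta>"
    using eventually_at_right_less[of 0] by eventually_elim auto
  then obtain r where "0 < r" "2 * cube_cost TYPE('a) r < \<eta>"
    using eventually_happens'[OF trivial_limit_at_right_real] by blast
  then show ?thesis using that by force
qed

lemma grow_volume:
  fixes C :: "'a::euclidean_space set"
  assumes "C \<in> lmeasurable" "E \<in> sets lebesgue" "E \<subseteq> C" "R > 0"
    "0 \<le> s" "s \<le> measure lebesgue ((C - E) \<inter> cube c R)"
  obtains E' where "E' \<in> sets lebesgue" "E' \<subseteq> C" "measure lebesgue E' = measure lebesgue E + s"
    "rel_perimeter C E' \<le> rel_perimeter C E + ereal (2 * cube_cost TYPE('a) R)"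
proof (cases "s = 0")
  case True
  moreover have "rel_perimeter C E + 0 \<le> rel_perimeter C E + ereal (2 * cube_cost TYPE('a) R)"
    using cube_cost_nonneg[of R, where 'a = 'a] assms(4) by (intro add_left_mono) simp
  ultimately show ?thesis using that[of E] assms by simp
next
  case False
  have E: "E \<in> lmeasurable" using assms by (auto intro: fmeasurableI2)
  have S: "C - E \<in> lmeasurable" using assms by (intro fmeasurable_Diff)
  obtain r where r: "0 < r" "r \<le> R" "measure lebesgue ((C - E) \<inter> cube c r) = s"
    using exists_cube_with_measure[OF S _ assms(6,4)] False assms(5) by auto
  let ?E' = "E \<union> cube c r \<inter> C"
  have "measure lebesgue (?E' - E) = measure lebesgue ?E' - measure lebesgue E"
    using E assms(1) by (intro measurable_measure_Diff) (auto intro!: fmeasurable.Un fmeasurable.Int simp: fmeasurableD)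
  moreover have "?E' - E = (C - E) \<inter> cube c r" by blast
  ultimately have "measure lebesgue ?E' = measure lebesgue E + s" using r(3) by simp
  moreover have "rel_perimeter C ?E' \<le> rel_perimeter C E + ereal (2 * cube_cost TYPE('a) r)"
    using assms r(1) by (intro rel_perimeter_Un_cube_le) (auto simp: fmeasurableD)
  moreover have "\<dots> \<le> rel_perimeter C E + ereal (2 * cube_cost TYPE('a) R)"
    using cube_cost_mono[of r R, where 'a = 'a] r by (intro add_left_mono) simp
  ultimately show ?thesis
    using assms by (intro that[of ?E']) (auto simp: fmeasurableD)
qed

lemma shrink_volume:
  fixes C :: "'a::euclidean_space set"
  assumes "C \<in> lmeasurable" "E \<in> sets lebesgue" "E \<subseteq> C" "R > 0"
    "0 \<le> s" "s \<le> measure lebesgue (E \<inter> cube c R)"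
  obtains E' where "E' \<in> sets lebesgue" "E' \<subseteq> C" "measure lebesgue E' = measure lebesgue E - s"
    "rel_perimeter C E' \<le> rel_perimeter C E + ereal (2 * cube_cost TYPE('a) R)"
proof (cases "s = 0")
  case True
  moreover have "rel_perimeter C E + 0 \<le> rel_perimeter C E + ereal (2 * cube_cost TYPE('a) R)"
    using cube_cost_nonneg[of R, where 'a = 'a] assms(4) by (intro add_left_mono) simp
  ultimately show ?thesis using that[of E] assms by simp
next
  case False
  have E: "E \<in> lmeasurable" using assms by (auto intro: fmeasurableI2)
  obtain r where r: "0 < r" "r \<le> R" "measure lebesgue (E \<inter> cube c r) = s"
    using exists_cube_with_measure[OF E _ assms(6,4)] False assms(5) by auto
  have "measure lebesgue (E - cube c r) = measure lebesgue (E - E \<inter> cube c r)"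
    by (simp add: Diff_Int)
  also have "\<dots> = measure lebesgue E - s"
    unfolding r(3)[symmetric] using E by (intro measurable_measure_Diff) (auto simp: fmeasurableD)
  finally have "measure lebesgue (E - cube c r) = measure lebesgue E - s" .
  moreover have "rel_perimeter C (E - cube c r) \<le> rel_perimeter C E + ereal (cube_cost TYPE('a) r)"
    using assms r(1) by (intro rel_perimeter_diff_cube_le)
  moreover have "\<dots> \<le> rel_perimeter C E + ereal (2 * cube_cost TYPE('a) R)"
    using cube_cost_mono[of r R, where 'a = 'a] cube_cost_nonneg[of R, where 'a = 'a] r
    by (intro add_left_mono) simp
  ultimately show ?thesis
    using assms by (intro that[of "E - cube c r"]) auto
qed

text \<open>
  Choose \<open>r\<close> so that a cube of size \<open>r\<close> costs at most \<open>\<eta>\<close>. Some such cube captures a definite amount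
  of \<open>C - E\<close> (if volume is to be gained) or of \<open>E\<close> (if it is to be lost), and shrinking the cube realises
  every smaller change of volume at no higher cost. The uniformity of \<open>\<theta>\<close> over all \<open>C \<subseteq> K\<close> is what makes
  a whole sequence of convex bodies tractable at once.
\<close>

lemma adjust_volume:
  fixes K :: "'a::euclidean_space set"
  assumes "DIM('a) \<ge> 2" "bounded K" "a > 0" "\<eta> > 0"
  obtains \<theta> where "\<theta> > 0"
    "\<And>C E v. C \<in> sets lebesgue \<Longrightarrow> C \<subseteq> K \<Longrightarrow> E \<in> sets lebesgue \<Longrightarrow> E \<subseteq> C \<Longrightarrow>
       \<bar>v - measure lebesgue E\<bar> \<le> \<theta> \<Longrightarrow> a \<le> v \<Longrightarrow> v \<le> measure lebesgue C - a \<Longrightarrow>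
       \<exists>E'. E' \<in> sets lebesgue \<and> E' \<subseteq> C \<and> measure lebesgue E' = v \<and>
         rel_perimeter C E' \<le> rel_perimeter C E + ereal \<eta>"
proof -
  obtain r where r: "r > 0" "2 * cube_cost TYPE('a) r \<le> \<eta>"
    by (rule cube_cost_small[OF assms(1,4)])
  obtain N where N: "N > 0" "\<And>S. S \<in> lmeasurable \<Longrightarrow> S \<subseteq> K \<Longrightarrow>
      \<exists>c. measure lebesgue S \<le> N * measure lebesgue (S \<inter> cube c r)"
    using bounded_pigeonhole_cube[OF assms(2) r(1)] by blast
  show ?thesis
  proof (rule that[of "a / N"])
    show "a / N > 0" using assms N by simp
    fix C E :: "'a set" and v :: real
    assume C: "C \<in> sets lebesgue" "C \<subseteq> K" and E: "E \<in> sets lebesgue" "E \<subseteq> C"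
      and v: "\<bar>v - measure lebesgue E\<bar> \<le> a / N" "a \<le> v" "v \<le> measure lebesgue C - a"
    have Cm: "C \<in> lmeasurable"
      using C assms(2) by (meson bounded_set_imp_lmeasurable bounded_subset)
    have Em: "E \<in> lmeasurable" using Cm E by (auto intro: fmeasurableI2)
    have "\<exists>E'. E' \<in> sets lebesgue \<and> E' \<subseteq> C \<and> measure lebesgue E' = v \<and>
         rel_perimeter C E' \<le> rel_perimeter C E + ereal (2 * cube_cost TYPE('a) r)"
    proof (cases "measure lebesgue E \<le> v")
      case True
      have S: "C - E \<in> lmeasurable" using Cm E by (intro fmeasurable_Diff)
      obtain c where c: "measure lebesgue (C - E) \<le> N * measure lebesgue ((C - E) \<inter> cube c r)"
        using N(2)[OF S] C(2) by blast
      have "measure lebesgue (C - E) = measure lebesgue C - measure lebesgue E"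
        using Cm E by (intro measurable_measure_Diff) auto
      with True v(3) c have "a \<le> N * measure lebesgue ((C - E) \<inter> cube c r)" by linarith
      with N(1) have "a / N \<le> measure lebesgue ((C - E) \<inter> cube c r)"
        by (simp add: divide_le_eq mult.commute)
      with v(1) True have "0 \<le> v - measure lebesgue E"
        "v - measure lebesgue E \<le> measure lebesgue ((C - E) \<inter> cube c r)" by auto
      from grow_volume[OF Cm E r(1) this] obtain E' where "E' \<in> sets lebesgue" "E' \<subseteq> C"
        "measure lebesgue E' = measure lebesgue E + (v - measure lebesgue E)"
        "rel_perimeter C E' \<le> rel_perimeter C E + ereal (2 * cube_cost TYPE('a) r)" .
      then show ?thesis by (intro exI[of _ E']) simp
    next
      case False
      obtain c where c: "measure lebesgue E \<le> N * measure lebesgue (E \<inter> cube c r)"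
        using N(2)[OF Em] C(2) E(2) by blast
      with False v(2) have "a \<le> N * measure lebesgue (E \<inter> cube c r)" by linarith
      with N(1) have "a / N \<le> measure lebesgue (E \<inter> cube c r)"
        by (simp add: divide_le_eq mult.commute)
      with v(1) False have "0 \<le> measure lebesgue E - v"
        "measure lebesgue E - v \<le> measure lebesgue (E \<inter> cube c r)" by auto
      from shrink_volume[OF Cm E r(1) this] obtain E' where "E' \<in> sets lebesgue" "E' \<subseteq> C"
        "measure lebesgue E' = measure lebesgue E - (measure lebesgue E - v)"
        "rel_perimeter C E' \<le> rel_perimeter C E + ereal (2 * cube_cost TYPE('a) r)" .
      then show ?thesis by (intro exI[of _ E']) simp
    qed
    then obtain E' where E': "E' \<in> sets lebesgue" "E' \<subseteq> C" "measure lebesgue E' = v"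
        "rel_perimeter C E' \<le> rel_perimeter C E + ereal (2 * cube_cost TYPE('a) r)"
      by (elim exE conjE)
    note E'(4)
    also have "rel_perimeter C E + ereal (2 * cube_cost TYPE('a) r) \<le> rel_perimeter C E + ereal \<eta>"
      using r by (intro add_left_mono) simp
    finally show "\<exists>E'. E' \<in> sets lebesgue \<and> E' \<subseteq> C \<and> measure lebesgue E' = v \<and>
         rel_perimeter C E' \<le> rel_perimeter C E + ereal \<eta>"
      using E' by (intro exI[of _ E'] conjI)
  qed
qed

section \<open>Comparison of isoperimetric profiles\<close>

lemma iso_profile_le:
  "E \<in> sets lebesgue \<Longrightarrow> E \<subseteq> C \<Longrightarrow> measure lebesgue E = v \<Longrightarrow> iso_profile C v \<le> rel_perimeter C E"
  unfolding iso_profile_def by (rule INF_lower) simp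

lemma iso_profile_geI:
  "(\<And>E. E \<in> sets lebesgue \<Longrightarrow> E \<subseteq> C \<Longrightarrow> measure lebesgue E = v \<Longrightarrow> p \<le> rel_perimeter C E)
    \<Longrightarrow> p \<le> iso_profile C v"
  unfolding iso_profile_def by (rule INF_greatest) simp

lemma iso_profile_nonneg: "0 \<le> iso_profile C v"
  by (intro iso_profile_geI rel_perimeter_nonneg)

text \<open>
  Test fields of \<open>D\<close> are test fields of \<open>C\<close>, and they do not see \<open>E\<close> outside \<open>D\<close>.
\<close>

lemma rel_perimeter_subset_le:
  assumes "D \<subseteq> C"
  shows "rel_perimeter D (E \<inter> D) \<le> rel_perimeter C E"
proof (rule rel_perimeter_leI)
  fix \<xi> assume \<xi>: "\<xi> \<in> test_fields D"
  then have \<xi>C: "\<xi> \<in> test_fields C"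
    using interior_mono[OF assms] by (auto simp: test_fields_def)
  have "(LINT x:E \<inter> D|lebesgue. divergence \<xi> x) = (LINT x:E|lebesgue. divergence \<xi> x)"
    unfolding set_lebesgue_integral_def
    using divergence_test_field(3)[OF \<xi>] interior_subset[of D]
    by (intro Bochner_Integration.integral_cong) (auto simp: indicator_def)
  then show "ereal (LINT x:E \<inter> D|lebesgue. divergence \<xi> x) \<le> rel_perimeter C E"
    using integral_le_rel_perimeter[OF \<xi>C, of E] by simp
qed

text \<open>
  If \<open>E\<close> competes in \<open>C\<close>, then \<open>E \<inter> D\<close> has no larger relative perimeter in \<open>D\<close>, and its volume is off by at
  most the volume of \<open>C - D\<close>; adjusting this volume costs \<open>\<eta>\<close>.
\<close>

lemma iso_profile_subset_le:
  fixes K :: "'a::euclidean_space set"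
  assumes "DIM('a) \<ge> 2" "bounded K" "a > 0" "\<eta> > 0"
  obtains \<theta> where "\<theta> > 0"
    "\<And>C D t. C \<in> sets lebesgue \<Longrightarrow> C \<subseteq> K \<Longrightarrow> D \<in> sets lebesgue \<Longrightarrow> D \<subseteq> C \<Longrightarrow>
       measure lebesgue C - measure lebesgue D \<le> \<theta> \<Longrightarrow> 0 \<le> t \<Longrightarrow> t \<le> 1 \<Longrightarrow>
       a \<le> t * measure lebesgue D \<Longrightarrow> t * measure lebesgue D \<le> measure lebesgue D - a \<Longrightarrow>
       iso_profile D (t * measure lebesgue D) \<le> iso_profile C (t * measure lebesgue C) + ereal \<eta>"
proof -
  obtain \<theta> where \<theta>: "\<theta> > 0" "\<And>C E v. C \<in> sets lebesgue \<Longrightarrow> C \<subseteq> K \<Longrightarrow> E \<in> sets lebesgue \<Longrightarrow> E \<subseteq> C \<Longrightarrow>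
       \<bar>v - measure lebesgue E\<bar> \<le> \<theta> \<Longrightarrow> a \<le> v \<Longrightarrow> v \<le> measure lebesgue C - a \<Longrightarrow>
       \<exists>E'. E' \<in> sets lebesgue \<and> E' \<subseteq> C \<and> measure lebesgue E' = v \<and>
         rel_perimeter C E' \<le> rel_perimeter C E + ereal \<eta>"
    by (rule adjust_volume[OF assms]) (rule that, assumption, blast)
  show ?thesis
  proof (rule that[OF \<theta>(1)])
    fix C D :: "'a set" and t :: real
    assume C: "C \<in> sets lebesgue" "C \<subseteq> K" and D: "D \<in> sets lebesgue" "D \<subseteq> C"
      and diff: "measure lebesgue C - measure lebesgue D \<le> \<theta>" and t: "0 \<le> t" "t \<le> 1"
      and v: "a \<le> t * measure lebesgue D" "t * measure lebesgue D \<le> measure lebesgue D - a"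
    have Cm: "C \<in> lmeasurable"
      using C assms(2) by (meson bounded_set_imp_lmeasurable bounded_subset)
    have CD: "measure lebesgue (C - D) = measure lebesgue C - measure lebesgue D"
      using Cm D by (intro measurable_measure_Diff) auto
    have "iso_profile D (t * measure lebesgue D) - ereal \<eta> \<le> iso_profile C (t * measure lebesgue C)"
    proof (rule iso_profile_geI)
      fix E assume E: "E \<in> sets lebesgue" "E \<subseteq> C" "measure lebesgue E = t * measure lebesgue C"
      have Em: "E \<in> lmeasurable" using Cm E by (auto intro: fmeasurableI2)
      have "measure lebesgue (E - D) = measure lebesgue (E - E \<inter> D)"
        by (simp add: Diff_Int)
      also have "\<dots> = measure lebesgue E - measure lebesgue (E \<inter> D)"
        using Em D by (intro measurable_measure_Diff) auto
      finally have "measure lebesgue E = measure lebesgue (E \<inter> D) + measure lebesgue (E - D)"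
        by simp
      moreover have "measure lebesgue (E - D) \<le> measure lebesgue (C - D)"
        using E Cm D by (intro measure_mono_fmeasurable fmeasurable_Diff) auto
      moreover have "0 \<le> measure lebesgue (E - D)" by simp
      moreover have "0 \<le> t * measure lebesgue (C - D)" "t * measure lebesgue (C - D) \<le> measure lebesgue (C - D)"
        using t by (auto intro: mult_left_le_one_le)
      then have "0 \<le> t * measure lebesgue C - t * measure lebesgue D"
        "t * measure lebesgue C - t * measure lebesgue D \<le> measure lebesgue C - measure lebesgue D"
        by (simp_all add: CD right_diff_distrib)
      ultimately have "\<bar>t * measure lebesgue D - measure lebesgue (E \<inter> D)\<bar> \<le> \<theta>"
        using diff unfolding E(3) CD by linarith
      then obtain E' where "E' \<in> sets lebesgue" "E' \<subseteq> D" "measure lebesgue E' = t * measure lebesgue D"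
         "rel_perimeter D E' \<le> rel_perimeter D (E \<inter> D) + ereal \<eta>"
        using \<theta>(2)[OF D(1) order_trans[OF D(2) C(2)] sets.Int[OF E(1) D(1)] Int_lower2 _ v] by blast
      then have "iso_profile D (t * measure lebesgue D) \<le> rel_perimeter D (E \<inter> D) + ereal \<eta>"
        by (intro order_trans[OF iso_profile_le])
      also have "\<dots> \<le> rel_perimeter C E + ereal \<eta>"
        by (intro add_right_mono rel_perimeter_subset_le D)
      finally show "iso_profile D (t * measure lebesgue D) - ereal \<eta> \<le> rel_perimeter C E"
        by (simp add: ereal_minus_le)
    qed
    then show "iso_profile D (t * measure lebesgue D) \<le> iso_profile C (t * measure lebesgue C) + ereal \<eta>"
      by (simp add: ereal_minus_le)
  qed
qed

text \<open>
  Starting from the empty set, a large cube intersected with \<open>C\<close> attains every volume up to that of \<open>C\<close>.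
\<close>

lemma iso_profile_bounded:
  fixes K :: "'a::euclidean_space set"
  assumes "bounded K"
  obtains M where "M \<ge> 0" "\<And>C t. C \<in> sets lebesgue \<Longrightarrow> C \<subseteq> K \<Longrightarrow> 0 \<le> t \<Longrightarrow> t \<le> 1 \<Longrightarrow>
     iso_profile C (t * measure lebesgue C) \<le> ereal M"
proof -
  obtain R where R: "R > 0" "\<And>x. x \<in> K \<Longrightarrow> norm x \<le> R"
    using assms by (auto simp: bounded_pos)
  have cube: "K \<subseteq> cube 0 R"
  proof
    fix x assume "x \<in> K"
    then show "x \<in> cube 0 R"
      using order_trans[OF Basis_le_norm R(2), of _ x] by (simp add: mem_cube)
  qed
  show ?thesis
  proof (rule that[of "2 * cube_cost TYPE('a) R"])
    show "0 \<le> 2 * cube_cost TYPE('a) R" using cube_cost_nonneg[of R, where 'a = 'a] R by simp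
    fix C :: "'a set" and t :: real assume C: "C \<in> sets lebesgue" "C \<subseteq> K" and t: "0 \<le> t" "t \<le> 1"
    have Cm: "C \<in> lmeasurable"
      using C assms by (meson bounded_set_imp_lmeasurable bounded_subset)
    have vol_nonneg: "0 \<le> t * measure lebesgue C" using t by simp
    have "(C - {}) \<inter> cube 0 R = C" using C cube by auto
    then have vol_le: "t * measure lebesgue C \<le> measure lebesgue ((C - {}) \<inter> cube 0 R)"
      using t by (simp add: mult_left_le_one_le)
    from grow_volume[OF Cm sets.empty_sets empty_subsetI R(1) vol_nonneg vol_le]
    obtain E' where "E' \<in> sets lebesgue" "E' \<subseteq> C"
      "measure lebesgue E' = measure lebesgue ({} :: 'a set) + t * measure lebesgue C"
      "rel_perimeter C E' \<le> rel_perimeter C {} + ereal (2 * cube_cost TYPE('a) R)" .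
    then show "iso_profile C (t * measure lebesgue C) \<le> ereal (2 * cube_cost TYPE('a) R)"
      using iso_profile_le[of E' C "t * measure lebesgue C"] by (simp add: rel_perimeter_empty)
  qed
qed

lemma ereal_norm_profile:
  assumes "bounded C" "C \<in> sets lebesgue" "0 \<le> t" "t \<le> 1"
  shows "iso_profile C (t * measure lebesgue C) = ereal (norm_profile C t)"
proof -
  obtain M where "\<And>D t. D \<in> sets lebesgue \<Longrightarrow> D \<subseteq> C \<Longrightarrow> 0 \<le> t \<Longrightarrow> t \<le> 1 \<Longrightarrow>
     iso_profile D (t * measure lebesgue D) \<le> ereal M"
    using iso_profile_bounded[OF assms(1)] by metis
  then have "iso_profile C (t * measure lebesgue C) \<le> ereal M" using assms by simp
  moreover have "0 \<le> iso_profile C (t * measure lebesgue C)" by (rule iso_profile_nonneg)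
  ultimately show ?thesis
    unfolding norm_profile_def by (cases "iso_profile C (t * measure lebesgue C)") auto
qed

lemma norm_profile_nonneg: "0 \<le> norm_profile C t"
  unfolding norm_profile_def by (intro real_of_ereal_pos iso_profile_nonneg)

section \<open>Behaviour under homotheties\<close>

lemma affine_image_eq_vimage:
  fixes a :: "'a::real_vector"
  assumes "l \<noteq> 0"
  shows "(\<lambda>x. l *\<^sub>R x + a) ` S = (\<lambda>y. (1 / l) *\<^sub>R y + (- (1 / l)) *\<^sub>R a) -` S"
proof -
  have "y = l *\<^sub>R x + a \<longleftrightarrow> (1 / l) *\<^sub>R y + (- (1 / l)) *\<^sub>R a = x" for x y
    using assms by (auto simp: scaleR_right_distrib scaleR_diff_right)
  then show ?thesis by (auto simp: image_iff simp del: scaleR_minus_left)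
qed

lemma affine_inverse_image:
  fixes a :: "'a::real_vector"
  assumes "l \<noteq> 0"
  shows "(\<lambda>y. (1 / l) *\<^sub>R y + (- (1 / l)) *\<^sub>R a) ` (\<lambda>x. l *\<^sub>R x + a) ` S = S"
  using assms by (simp add: image_image scaleR_right_distrib)

lemma lebesgue_affine_map:
  fixes a :: "'a::euclidean_space"
  assumes "l > 0"
  shows "lebesgue = density (distr lebesgue lebesgue (\<lambda>x. l *\<^sub>R x + a)) (\<lambda>_. ennreal (l ^ DIM('a)))"
    and "(\<lambda>x. l *\<^sub>R x + a) \<in> lebesgue \<rightarrow>\<^sub>M lebesgue"
proof -
  have eq: "(\<lambda>x. a + (\<Sum>j\<in>Basis. (l * (x \<bullet> j)) *\<^sub>R j)) = (\<lambda>x. l *\<^sub>R x + a)"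
    unfolding scaleR_scaleR[symmetric] scaleR_sum_right[symmetric] euclidean_representation
    by (simp add: add.commute)
  show "lebesgue = density (distr lebesgue lebesgue (\<lambda>x. l *\<^sub>R x + a)) (\<lambda>_. ennreal (l ^ DIM('a)))"
    using lebesgue_affine_euclidean[of "\<lambda>_. l" a] assms unfolding eq by simp
  show "(\<lambda>x. l *\<^sub>R x + a) \<in> lebesgue \<rightarrow>\<^sub>M lebesgue"
    using lebesgue_affine_measurable[of "\<lambda>_. l" a] assms unfolding eq by simp
qed

lemma lebesgue_sets_affine_image:
  fixes a :: "'a::euclidean_space"
  assumes "l > 0" "S \<in> sets lebesgue"
  shows "(\<lambda>x. l *\<^sub>R x + a) ` S \<in> sets lebesgue"
proof -
  have "(\<lambda>y. (1 / l) *\<^sub>R y + (- (1 / l)) *\<^sub>R a) -` S \<inter> space lebesgue \<in> sets lebesgue"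
    using assms by (intro measurable_sets[OF lebesgue_affine_map(2)]) auto
  then show ?thesis
    using assms by (subst affine_image_eq_vimage) auto
qed

lemma set_integral_affine:
  fixes a :: "'a::euclidean_space" and w :: "'a \<Rightarrow> real"
  assumes "l > 0" "E \<in> sets lebesgue" "w \<in> borel_measurable lebesgue"
  shows "(LINT y:(\<lambda>x. l *\<^sub>R x + a) ` E|lebesgue. w y) = l ^ DIM('a) * (LINT x:E|lebesgue. w (l *\<^sub>R x + a))"
proof -
  let ?h = "\<lambda>x. l *\<^sub>R x + a"
  define f where "f = (\<lambda>y. indicator (?h ` E) y *\<^sub>R w y)"
  have f: "f \<in> borel_measurable lebesgue"
    unfolding f_def
    using lebesgue_sets_affine_image[OF assms(1,2)] assms(3)
    by (intro borel_measurable_scaleR borel_measurable_indicator)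
  have "(\<integral>y. f y \<partial>lebesgue) = (\<integral>y. f y \<partial>density (distr lebesgue lebesgue ?h) (\<lambda>_. ennreal (l ^ DIM('a))))"
    using lebesgue_affine_map(1)[OF assms(1), of a] by simp
  also have "\<dots> = (\<integral>y. l ^ DIM('a) *\<^sub>R f y \<partial>distr lebesgue lebesgue ?h)"
    using assms(1) f by (intro integral_density) auto
  also have "\<dots> = (\<integral>x. l ^ DIM('a) *\<^sub>R f (?h x) \<partial>lebesgue)"
    using f by (intro integral_distr lebesgue_affine_map(2) assms(1)) auto
  also have "\<dots> = l ^ DIM('a) * (\<integral>x. f (?h x) \<partial>lebesgue)"
    by simp
  also have "(\<lambda>x. f (?h x)) = (\<lambda>x. indicator E x *\<^sub>R w (?h x))"
    using assms(1) by (intro ext) (auto simp: f_def indicator_def)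
  finally show ?thesis by (simp add: f_def set_lebesgue_integral_def)
qed

lemma test_fields_affine:
  fixes a :: "'a::euclidean_space"
  assumes "l > 0" and \<xi>: "\<xi> \<in> test_fields ((\<lambda>x. l *\<^sub>R x + a) ` C)"
  shows "(\<lambda>x. \<xi> (l *\<^sub>R x + a)) \<in> test_fields C"
proof -
  let ?h = "\<lambda>x. l *\<^sub>R x + a"
  let ?g = "\<lambda>y. (1 / l) *\<^sub>R y + (- (1 / l)) *\<^sub>R a"
  note \<xi>' = test_fieldsD[OF \<xi>]
  let ?S = "closure {x. \<xi> x \<noteq> 0}"
  have comp: "compact (?g ` ?S)"
    using \<xi>'(2) by (intro compact_continuous_image continuous_intros)
  have "{x. \<xi> (?h x) \<noteq> 0} \<subseteq> ?g ` ?S"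
  proof
    fix x assume "x \<in> {x. \<xi> (?h x) \<noteq> 0}"
    then have "?h x \<in> ?S" using subsetD[OF closure_subset, of "?h x" "{x. \<xi> x \<noteq> 0}"] by simp
    moreover have "x = ?g (?h x)" using assms(1) by (simp add: scaleR_right_distrib)
    ultimately show "x \<in> ?g ` ?S" by (rule rev_image_eqI)
  qed
  then have sub: "closure {x. \<xi> (?h x) \<noteq> 0} \<subseteq> ?g ` ?S"
    by (intro closure_minimal compact_imp_closed comp)
  then have "compact (closure {x. \<xi> (?h x) \<noteq> 0})"
    using comp by (meson closed_closure compact_eq_bounded_closed bounded_subset)
  moreover have "?g ` interior (?h ` C) \<subseteq> interior C"
  proof (rule interior_maximal)
    show "?g ` interior (?h ` C) \<subseteq> C"
      using image_mono[OF interior_subset[of "?h ` C"], of ?g] affine_inverse_image[of l a C] assms(1)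
      by simp
    have "open ((\<lambda>x. (- (1 / l)) *\<^sub>R a + (1 / l) *\<^sub>R x) ` interior (?h ` C))"
      using assms(1) by (intro open_affinity) auto
    then show "open (?g ` interior (?h ` C))" by (simp add: add.commute)
  qed
  then have "closure {x. \<xi> (?h x) \<noteq> 0} \<subseteq> interior C"
    using sub image_mono[OF \<xi>'(3), of ?g] by (meson order_trans)
  ultimately show ?thesis
    using \<xi>'(4) smooth_compose_affine[OF \<xi>'(1)] by (simp add: test_fields_def)
qed

lemma divergence_affine:
  fixes a :: "'a::euclidean_space"
  assumes "smooth \<xi>"
  shows "divergence (\<lambda>x. \<xi> (l *\<^sub>R x + a)) x = l * divergence \<xi> (l *\<^sub>R x + a)"
proof -
  have f: "(\<xi> has_derivative frechet_derivative \<xi> (at (l *\<^sub>R x + a))) (at (l *\<^sub>R x + a))"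
    by (rule smooth_has_derivative[OF assms])
  have "((\<lambda>x. l *\<^sub>R x + a) has_derivative (\<lambda>v. l *\<^sub>R v)) (at x)"
    by (auto intro!: derivative_eq_intros)
  from frechet_derivative_at[OF has_derivative_compose[OF this f]]
  have "frechet_derivative (\<lambda>x. \<xi> (l *\<^sub>R x + a)) (at x) =
      (\<lambda>v. l *\<^sub>R frechet_derivative \<xi> (at (l *\<^sub>R x + a)) v)"
    by (simp add: linear_cmul[OF has_derivative_linear[OF f]])
  then show ?thesis by (simp add: divergence_def sum_distrib_left)
qed

lemma rel_perimeter_affine_le:
  fixes a :: "'a::euclidean_space"
  assumes "l > 0" "E \<in> sets lebesgue"
  shows "rel_perimeter ((\<lambda>x. l *\<^sub>R x + a) ` C) ((\<lambda>x. l *\<^sub>R x + a) ` E)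
    \<le> ereal (l ^ (DIM('a) - 1)) * rel_perimeter C E"
proof (rule rel_perimeter_leI)
  let ?h = "\<lambda>x. l *\<^sub>R x + a"
  fix \<xi> assume \<xi>: "\<xi> \<in> test_fields (?h ` C)"
  have "continuous_on UNIV (divergence \<xi>)"
    using test_fieldsD(1)[OF \<xi>] by (rule continuous_on_divergence)
  then have "divergence \<xi> \<in> borel_measurable lebesgue"
    by (intro measurable_completion) (simp add: borel_measurable_continuous_onI)
  then have "(LINT y:?h ` E|lebesgue. divergence \<xi> y) = l ^ DIM('a) * (LINT x:E|lebesgue. divergence \<xi> (?h x))"
    using assms by (intro set_integral_affine)
  also have "l ^ DIM('a) = l ^ (DIM('a) - 1) * l"
    by (metis DIM_positive power_minus_mult)
  also have "l ^ (DIM('a) - 1) * l * (LINT x:E|lebesgue. divergence \<xi> (?h x))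
      = l ^ (DIM('a) - 1) * (LINT x:E|lebesgue. divergence (\<lambda>x. \<xi> (?h x)) x)"
    by (simp add: divergence_affine[OF test_fieldsD(1)[OF \<xi>]])
  also have "ereal \<dots> = ereal (l ^ (DIM('a) - 1)) * ereal (LINT x:E|lebesgue. divergence (\<lambda>x. \<xi> (?h x)) x)"
    by simp
  also have "\<dots> \<le> ereal (l ^ (DIM('a) - 1)) * rel_perimeter C E"
    using assms by (intro ereal_mult_left_mono integral_le_rel_perimeter test_fields_affine[OF _ \<xi>]) auto
  finally show "ereal (LINT y:?h ` E|lebesgue. divergence \<xi> y) \<le> ereal (l ^ (DIM('a) - 1)) * rel_perimeter C E" .
qed

lemma measure_affine:
  fixes a :: "'a::euclidean_space"
  assumes "l > 0"
  shows "measure lebesgue ((\<lambda>x. l *\<^sub>R x + a) ` S) = l ^ DIM('a) * measure lebesgue S"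
  using measure_lebesgue_affine[of l a S] assms by simp

text \<open>
  Pull competitors back by the inverse homothety. Applied to the inverse map as well, the inequality
  becomes the equality of \<open>norm_profile_affine\<close>.
\<close>

lemma iso_profile_affine_ge:
  fixes a :: "'a::euclidean_space"
  assumes "l > 0"
  shows "ereal (l ^ (DIM('a) - 1)) * iso_profile C v \<le> iso_profile ((\<lambda>x. l *\<^sub>R x + a) ` C) (l ^ DIM('a) * v)"
proof (rule iso_profile_geI)
  let ?h = "\<lambda>x. l *\<^sub>R x + a"
  let ?g = "\<lambda>y. (1 / l) *\<^sub>R y + (- (1 / l)) *\<^sub>R a"
  have l: "1 / l > 0" using assms by simp
  have gh: "?g ` ?h ` C = C" using assms by (intro affine_inverse_image) simp
  fix E assume E: "E \<in> sets lebesgue" "E \<subseteq> ?h ` C" "measure lebesgue E = l ^ DIM('a) * v"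
  have "iso_profile C v \<le> rel_perimeter C (?g ` E)"
  proof (rule iso_profile_le)
    show "?g ` E \<in> sets lebesgue" by (rule lebesgue_sets_affine_image[OF l E(1)])
    show "?g ` E \<subseteq> C" using image_mono[OF E(2), of ?g] gh by simp
    show "measure lebesgue (?g ` E) = v"
      using assms by (simp add: measure_affine[OF l] E(3) power_one_over del: scaleR_minus_left)
  qed
  also have "\<dots> \<le> ereal ((1 / l) ^ (DIM('a) - 1)) * rel_perimeter (?h ` C) E"
    using rel_perimeter_affine_le[OF l E(1), of "(- (1 / l)) *\<^sub>R a" "?h ` C"] unfolding gh .
  finally have "ereal (l ^ (DIM('a) - 1)) * iso_profile C v
      \<le> ereal (l ^ (DIM('a) - 1)) * (ereal ((1 / l) ^ (DIM('a) - 1)) * rel_perimeter (?h ` C) E)"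
    using assms by (intro ereal_mult_left_mono) auto
  also have "\<dots> = rel_perimeter (?h ` C) E"
    using assms by (simp add: mult.assoc[symmetric] power_one_over one_ereal_def[symmetric])
  finally show "ereal (l ^ (DIM('a) - 1)) * iso_profile C v \<le> rel_perimeter (?h ` C) E" .
qed

lemma norm_profile_affine:
  fixes a :: "'a::euclidean_space"
  assumes "l > 0" "bounded C" "C \<in> sets lebesgue" "0 \<le> t" "t \<le> 1"
  shows "norm_profile ((\<lambda>x. l *\<^sub>R x + a) ` C) t = l ^ (DIM('a) - 1) * norm_profile C t"
proof -
  have ge: "l ^ (DIM('a) - 1) * norm_profile C t \<le> norm_profile ((\<lambda>x. l *\<^sub>R x + a) ` C) t"
    if "l > 0" "bounded C" "C \<in> sets lebesgue" for l a and C :: "'a set"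
  proof -
    let ?D = "(\<lambda>x. l *\<^sub>R x + a) ` C"
    have "bounded ((\<lambda>x. a + x) ` (\<lambda>x. l *\<^sub>R x) ` C)"
      using that by (intro bounded_translation bounded_scaling)
    then have "bounded ?D" by (simp add: image_image add.commute)
    moreover have "?D \<in> sets lebesgue" using that by (intro lebesgue_sets_affine_image)
    moreover have "ereal (l ^ (DIM('a) - 1)) * iso_profile C (t * measure lebesgue C)
        \<le> iso_profile ?D (t * measure lebesgue ?D)"
      using iso_profile_affine_ge[OF that(1), of C "t * measure lebesgue C" a]
      by (simp add: measure_affine[OF that(1)] mult_ac)
    ultimately show ?thesis
      using that assms(4,5) by (simp add: ereal_norm_profile)
  qed
  let ?D = "(\<lambda>x. l *\<^sub>R x + a) ` C"
  have "bounded ((\<lambda>x. a + x) ` (\<lambda>x. l *\<^sub>R x) ` C)"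
    using assms by (intro bounded_translation bounded_scaling)
  then have "bounded ?D" by (simp add: image_image add.commute)
  moreover have "?D \<in> sets lebesgue" using assms by (intro lebesgue_sets_affine_image)
  ultimately have "(1 / l) ^ (DIM('a) - 1) * norm_profile ?D t \<le> norm_profile C t"
    using ge[of "1 / l" ?D "(- (1 / l)) *\<^sub>R a"] assms(1) affine_inverse_image[of l a C] by simp
  then have "norm_profile ?D t \<le> l ^ (DIM('a) - 1) * norm_profile C t"
    using assms(1) by (simp add: power_one_over field_simps)
  with ge[OF assms(1-3), of a] show ?thesis by simp
qed

section \<open>Hausdorff convergence and homothetic copies\<close>

lemma hausdorff_dist_less_imp_subset:
  fixes C D :: "'a::euclidean_space set"
  assumes "hausdorff_dist C D < e" "bounded C" "bounded D" "C \<noteq> {}" "D \<noteq> {}"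
  shows "C \<subseteq> closed_nbhd e D" "D \<subseteq> closed_nbhd e C"
proof -
  let ?R = "{r. 0 < r \<and> C \<subseteq> closed_nbhd r D \<and> D \<subseteq> closed_nbhd r C}"
  obtain c d where cd: "c \<in> C" "d \<in> D" using assms by blast
  obtain B where B: "B > 0" "\<And>x. x \<in> C \<union> D \<Longrightarrow> norm x \<le> B"
    using assms(2,3) bounded_Un[of C D] unfolding bounded_pos by blast
  have near: "infdist x S \<le> 2 * B" if "x \<in> C \<union> D" "s \<in> S" "s \<in> C \<union> D" for x s S
  proof -
    have "infdist x S \<le> dist x s" using that(2) by (rule infdist_le)
    also have "\<dots> \<le> norm x + norm s" by (simp add: dist_norm norm_triangle_ineq4)
    finally show ?thesis using B(2)[OF that(1)] B(2)[OF that(3)] by linarith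
  qed
  have "2 * B \<in> ?R"
    using B(1) near[OF _ cd(1)] near[OF _ cd(2)] cd by (auto simp: closed_nbhd_def)
  then have "?R \<noteq> {}" by blast
  then obtain r where "r \<in> ?R" "r < e"
    using cInf_lessD[of ?R e] assms(1) unfolding hausdorff_dist_def by blast
  then show "C \<subseteq> closed_nbhd e D" "D \<subseteq> closed_nbhd e C"
    by (force simp: closed_nbhd_def)+
qed

text \<open>
  The displacement is written as \<open>s *\<^sub>R u\<close> with \<open>norm u \<le> \<rho>\<close> because \<open>u\<close> will be absorbed into a ball of
  radius \<open>\<rho>\<close> inscribed in the limit body.
\<close>

lemma in_closed_nbhdE:
  fixes D :: "'a::euclidean_space set"
  assumes "x \<in> closed_nbhd (s * \<rho>) D" "compact D" "D \<noteq> {}" "s > 0" "\<rho> > 0"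
  obtains z u where "z \<in> D" "norm u \<le> \<rho>" "x = z + s *\<^sub>R u"
proof -
  obtain z where z: "z \<in> D" "infdist x D = dist x z"
    using infdist_attains_inf[of D x] assms by (auto simp: compact_imp_closed)
  have "norm ((1 / s) *\<^sub>R (x - z)) \<le> \<rho>"
    using assms z by (simp add: closed_nbhd_def dist_norm divide_le_eq mult.commute)
  then show ?thesis using z(1) assms(4) by (intro that[of z "(1 / s) *\<^sub>R (x - z)"]) auto
qed

definition homothety :: "'a::real_vector \<Rightarrow> real \<Rightarrow> 'a \<Rightarrow> 'a" where
  "homothety x0 l x = l *\<^sub>R x + (1 - l) *\<^sub>R x0"

text \<open>
  With \<open>x0\<close> as origin, \<open>C + s B \<subseteq> C + s C = (1 + s) C\<close> for the ball \<open>B\<close> of radius \<open>\<rho>\<close>, which is contained in \<open>C\<close>.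
\<close>

lemma subset_homothety:
  fixes C D :: "'a::euclidean_space set"
  assumes "compact C" "convex C" "cball x0 \<rho> \<subseteq> C" "\<rho> > 0" "s > 0" "D \<subseteq> closed_nbhd (s * \<rho>) C"
  shows "D \<subseteq> homothety x0 (1 + s) ` C"
proof
  fix y assume "y \<in> D"
  have "x0 \<in> C" using assms(3,4) by auto
  then obtain c u where cu: "c \<in> C" "norm u \<le> \<rho>" "y = c + s *\<^sub>R u"
    using in_closed_nbhdE[of y s \<rho> C] assms \<open>y \<in> D\<close> by blast
  have u: "x0 + u \<in> C" using cu(2) assms(3) by (auto simp: dist_norm)
  let ?z = "(1 / (1 + s)) *\<^sub>R c + (s / (1 + s)) *\<^sub>R (x0 + u)"
  have "?z \<in> C"
    using assms(5) by (intro convexD[OF assms(2) cu(1) u]) (auto simp: divide_simps)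
  moreover have "y = homothety x0 (1 + s) ?z"
  proof -
    have "(1 + s) *\<^sub>R ?z = c + s *\<^sub>R (x0 + u)"
      using assms(5) by (simp add: scaleR_right_distrib)
    then show ?thesis by (simp add: homothety_def cu(3) algebra_simps)
  qed
  ultimately show "y \<in> homothety x0 (1 + s) ` C" by blast
qed

text \<open>
  With \<open>x0\<close> as origin and \<open>B\<close> the ball of radius \<open>\<rho>\<close>, one has \<open>C \<subseteq> D + s B \<subseteq> D + s C\<close>, so the minimum of a
  linear functional over \<open>D\<close> is at most \<open>1 - s\<close> times its minimum over \<open>C\<close>. A hyperplane separating a
  point of \<open>(1 - s) C\<close> from \<open>D\<close> would contradict this.
\<close>

lemma homothety_subset:
  fixes C D :: "'a::euclidean_space set"
  assumes "compact C" "cball x0 \<rho> \<subseteq> C" "\<rho> > 0" "0 < s" "s < 1"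
    "compact D" "convex D" "D \<noteq> {}" "C \<subseteq> closed_nbhd (s * \<rho>) D"
  shows "homothety x0 (1 - s) ` C \<subseteq> D"
proof (rule ccontr)
  assume "\<not> ?thesis"
  then obtain c where c: "c \<in> C" "homothety x0 (1 - s) c \<notin> D" by blast
  obtain a b where ab: "a \<bullet> homothety x0 (1 - s) c < b" "\<And>x. x \<in> D \<Longrightarrow> b < a \<bullet> x"
    using separating_hyperplane_closed_point[OF assms(7) compact_imp_closed[OF assms(6)] c(2)] by blast
  have "continuous_on C (\<lambda>x. a \<bullet> x)" by (intro continuous_intros)
  then obtain m where m: "m \<in> C" "\<And>x. x \<in> C \<Longrightarrow> a \<bullet> m \<le> a \<bullet> x"
    using continuous_attains_inf[OF assms(1), of "\<lambda>x. a \<bullet> x"] c(1) by blast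
  obtain z u where z: "z \<in> D" "norm u \<le> \<rho>" "m = z + s *\<^sub>R u"
    using in_closed_nbhdE[of m s \<rho> D] assms m(1) by blast
  have "x0 + u \<in> C" using z(2) assms(2) by (auto simp: dist_norm)
  then have "a \<bullet> m \<le> a \<bullet> x0 + a \<bullet> u"
    using m(2) by (metis inner_add_right)
  then have "s * (a \<bullet> m) \<le> s * (a \<bullet> x0 + a \<bullet> u)"
    using assms(4) by (intro mult_left_mono) auto
  moreover have "(1 - s) * (a \<bullet> m) \<le> (1 - s) * (a \<bullet> c)"
    using assms(5) m(2)[OF c(1)] by (intro mult_left_mono) auto
  moreover have "a \<bullet> z = a \<bullet> m - s * (a \<bullet> u)" by (simp add: z(3) inner_add_right)
  moreover have "a \<bullet> homothety x0 (1 - s) c = (1 - s) * (a \<bullet> c) + s * (a \<bullet> x0)"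
    by (simp add: homothety_def inner_add_right)
  ultimately have "a \<bullet> z \<le> a \<bullet> homothety x0 (1 - s) c" by (simp add: algebra_simps)
  then show False using ab(1) ab(2)[OF z(1)] by linarith
qed

section \<open>Convergence of the profiles\<close>

lemma convex_body_measurable:
  assumes "convex_body C"
  shows "C \<in> sets lebesgue" "bounded C"
  using assms by (auto simp: convex_body_def compact_imp_bounded intro: fmeasurableD lmeasurable_compact)

lemma eventually_sandwich:
  fixes C :: "nat \<Rightarrow> 'a::euclidean_space set"
  assumes "\<And>i. convex_body (C i)" "convex_body L" "(\<lambda>i. hausdorff_dist (C i) L) \<longlonglongrightarrow> 0"
    and "cball x0 \<rho> \<subseteq> L" "\<rho> > 0" "0 < s" "s < 1"
  shows "\<forall>\<^sub>F i in sequentially. homothety x0 (1 - s) ` L \<subseteq> C i \<and> C i \<subseteq> homothety x0 (1 + s) ` L"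
proof -
  have "\<forall>\<^sub>F i in sequentially. hausdorff_dist (C i) L < s * \<rho>"
    using assms by (intro order_tendstoD(2)[OF assms(3)]) simp
  then show ?thesis
  proof eventually_elim
    case (elim i)
    have L: "compact L" "convex L" "L \<noteq> {}" "bounded L" and
      C: "compact (C i)" "convex (C i)" "C i \<noteq> {}" "bounded (C i)"
      using assms(1)[of i] assms(2) by (auto simp: convex_body_def compact_imp_bounded)
    note sub = hausdorff_dist_less_imp_subset[OF elim C(4) L(4) C(3) L(3)]
    show ?case
      using homothety_subset[OF L(1) assms(4-7) C(1-3) sub(2)]
        subset_homothety[OF L(1,2) assms(4-6) sub(1)] by blast
  qed
qed

text \<open>
  Let \<open>D\<^sub>1 \<subseteq> C i \<subseteq> D\<^sub>2\<close> be the two homothetic copies of \<open>L\<close>, with ratios \<open>1 - s\<close> and \<open>1 + s\<close>. The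
  comparison of profiles under inclusion, applied to both inclusions, encloses the profile of \<open>C i\<close> between
  those of \<open>D\<^sub>1\<close> and \<open>D\<^sub>2\<close> up to \<open>e / 2\<close>, and the latter are \<open>(1 - s)\<^sup>n\<close> and \<open>(1 + s)\<^sup>n\<close> times the profile
  of \<open>L\<close>. The bound \<open>M\<close> turns these factors into an additive error; it also confines
  all profiles to one compact interval, on which the power function is uniformly continuous.
\<close>

lemma norm_profile_convergence:
  fixes C :: "nat \<Rightarrow> 'a::euclidean_space set"
  assumes dim: "DIM('a) \<ge> 2" and C: "\<And>i. convex_body (C i)" and L: "convex_body L"
    and lim: "(\<lambda>i. hausdorff_dist (C i) L) \<longlonglongrightarrow> 0"
  obtains M where
    "\<And>t. 0 \<le> t \<Longrightarrow> t \<le> 1 \<Longrightarrow> norm_profile L t \<le> M"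
    "\<forall>\<^sub>F i in sequentially. \<forall>t. 0 \<le> t \<and> t \<le> 1 \<longrightarrow> norm_profile (C i) t \<le> M"
    "\<And>\<alpha> e. \<alpha> > 0 \<Longrightarrow> e > 0 \<Longrightarrow> \<forall>\<^sub>F i in sequentially. \<forall>t. \<alpha> \<le> t \<and> t \<le> 1 - \<alpha> \<longrightarrow>
       \<bar>norm_profile (C i) t - norm_profile L t\<bar> < e"
proof -
  obtain x0 \<rho> where ball: "cball x0 \<rho> \<subseteq> L" "\<rho> > 0"
    using L unfolding convex_body_def by (metis ex_in_conv mem_interior_cball)
  let ?V = "measure lebesgue L"
  let ?h = "homothety x0"
  let ?n = "DIM('a) - 1"
  note Lm = convex_body_measurable[OF L]
  note Cm = convex_body_measurable[OF C]
  have Llm: "L \<in> lmeasurable" using Lm by (simp add: bounded_set_imp_lmeasurable)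
  have "0 < measure lebesgue (cball x0 \<rho>)" using ball by (simp add: content_cball_pos)
  also have "\<dots> \<le> ?V" using ball Llm by (intro measure_mono_fmeasurable) auto
  finally have V: "?V > 0" .
  have h: "?h l = (\<lambda>x. l *\<^sub>R x + (1 - l) *\<^sub>R x0)" for l
    by (simp add: homothety_def fun_eq_iff)
  have hV: "measure lebesgue (?h l ` L) = l ^ DIM('a) * ?V" if "l > 0" for l
    unfolding h by (rule measure_affine[OF that])
  have h_meas: "?h l ` L \<in> sets lebesgue" if "l > 0" for l
    unfolding h using that Lm(1) by (rule lebesgue_sets_affine_image)
  have hJ: "norm_profile (?h l ` L) t = l ^ ?n * norm_profile L t" if "l > 0" "0 \<le> t" "t \<le> 1" for l t
    unfolding h using that Lm by (intro norm_profile_affine)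
  obtain B where B: "B > 0" "\<And>x. x \<in> L \<Longrightarrow> norm x \<le> B"
    using Lm(2) by (auto simp: bounded_pos)
  \<comment> \<open>a common container of all homothetic copies of ratio at most \<open>2\<close>\<close>
  define K where "K = cball (0::'a) (2 * B + norm x0)"
  have K: "bounded K" by (simp add: K_def)
  have hK: "?h l ` L \<subseteq> K" if "0 < l" "l \<le> 2" for l
  proof
    fix y assume "y \<in> ?h l ` L"
    then obtain x where x: "x \<in> L" "y = ?h l x" by blast
    have "norm y \<le> norm (l *\<^sub>R x) + norm ((1 - l) *\<^sub>R x0)"
      unfolding x(2) homothety_def by (rule norm_triangle_ineq)
    also have "\<dots> = l * norm x + \<bar>1 - l\<bar> * norm x0" using that by simp
    also have "\<dots> \<le> 2 * B + 1 * norm x0"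
      using that B(2)[OF x(1)] B(1) by (intro add_mono mult_mono mult_right_mono) auto
    finally show "y \<in> K" by (simp add: K_def)
  qed
  have LK: "L \<subseteq> K" using hK[of 1] by (simp add: h)
  obtain M where M: "M \<ge> 0" "\<And>D t. D \<in> sets lebesgue \<Longrightarrow> D \<subseteq> K \<Longrightarrow> 0 \<le> t \<Longrightarrow> t \<le> 1 \<Longrightarrow>
     iso_profile D (t * measure lebesgue D) \<le> ereal M"
    by (rule iso_profile_bounded[OF K]) (rule that, assumption, blast)
  have bound: "norm_profile D t \<le> M" if "D \<in> sets lebesgue" "D \<subseteq> K" "0 \<le> t" "t \<le> 1" for D t
    using M(2)[OF that] ereal_norm_profile[OF bounded_subset[OF K that(2)] that(1,3,4)] by simp
  have CK: "\<forall>\<^sub>F i in sequentially. C i \<subseteq> K"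
  proof -
    have "\<forall>\<^sub>F i in sequentially. ?h (1 - 1 / 2) ` L \<subseteq> C i \<and> C i \<subseteq> ?h (1 + 1 / 2) ` L"
      by (intro eventually_sandwich[OF C L lim ball]) auto
    moreover have "?h (1 + 1 / 2) ` L \<subseteq> K" by (rule hK) auto
    ultimately show ?thesis by (elim eventually_mono) (meson order_trans)
  qed
  show ?thesis
  proof (rule that[of M])
    show "norm_profile L t \<le> M" if "0 \<le> t" "t \<le> 1" for t
      using bound[OF Lm(1) LK that] .
    show "\<forall>\<^sub>F i in sequentially. \<forall>t. 0 \<le> t \<and> t \<le> 1 \<longrightarrow> norm_profile (C i) t \<le> M"
      using CK by eventually_elim (use bound Cm in blast)
  next
    fix \<alpha> e :: real assume \<alpha>: "\<alpha> > 0" and e: "e > 0"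
    \<comment> \<open>a lower bound for \<open>\<alpha> * measure lebesgue D\<close> for every body \<open>D\<close> containing a copy of \<open>L\<close> of ratio
      at least \<open>1 / 2\<close>; it keeps the volumes compared below away from both ends\<close>
    define a where "a = \<alpha> * ((1 / 2) ^ DIM('a) * ?V)"
    have a: "a > 0" using \<alpha> V by (simp add: a_def)
    obtain \<theta> where \<theta>: "\<theta> > 0"
      "\<And>C D t. C \<in> sets lebesgue \<Longrightarrow> C \<subseteq> K \<Longrightarrow> D \<in> sets lebesgue \<Longrightarrow> D \<subseteq> C \<Longrightarrow>
       measure lebesgue C - measure lebesgue D \<le> \<theta> \<Longrightarrow> 0 \<le> t \<Longrightarrow> t \<le> 1 \<Longrightarrow>
       a \<le> t * measure lebesgue D \<Longrightarrow> t * measure lebesgue D \<le> measure lebesgue D - a \<Longrightarrow>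
       iso_profile D (t * measure lebesgue D) \<le> iso_profile C (t * measure lebesgue C) + ereal (e / 2)"
      by (rule iso_profile_subset_le[OF dim K a half_gt_zero[OF e]]) (rule that, assumption, blast)
    have compare: "norm_profile D t \<le> norm_profile C t + e / 2"
      if "C \<in> sets lebesgue" "C \<subseteq> K" "D \<in> sets lebesgue" "D \<subseteq> C" "measure lebesgue C - measure lebesgue D \<le> \<theta>"
        "(1 / 2) ^ DIM('a) * ?V \<le> measure lebesgue D" "\<alpha> \<le> t" "t \<le> 1 - \<alpha>" for C D t
    proof -
      have a_le: "a \<le> \<alpha> * measure lebesgue D"
        unfolding a_def using \<alpha> that(6) by (intro mult_left_mono) auto
      have 1: "\<alpha> * measure lebesgue D \<le> t * measure lebesgue D"
        "t * measure lebesgue D \<le> (1 - \<alpha>) * measure lebesgue D"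
        using that by (auto intro: mult_right_mono)
      have t: "0 \<le> t" "t \<le> 1" using that \<alpha> by auto
      have "bounded C" "bounded D" using that K by (meson bounded_subset)+
      moreover have "iso_profile D (t * measure lebesgue D) \<le> iso_profile C (t * measure lebesgue C) + ereal (e / 2)"
        using a_le 1 by (intro \<theta>(2) that t) (auto simp: left_diff_distrib)
      ultimately show ?thesis using that t by (simp add: ereal_norm_profile)
    qed
    \<comment> \<open>the two copies have to be close in volume, and their scaling factors close to each other\<close>
    have "((\<lambda>s. (1 + s) ^ DIM('a) * ?V - (1 - s) ^ DIM('a) * ?V) \<longlongrightarrow>
        (1 + 0) ^ DIM('a) * ?V - (1 - 0) ^ DIM('a) * ?V) (at_right 0)"
      by (intro tendsto_intros)
    then have ev1: "\<forall>\<^sub>F s in at_right 0. (1 + s) ^ DIM('a) * ?V - (1 - s) ^ DIM('a) * ?V < \<theta>"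
      using \<theta>(1) by (intro order_tendstoD) auto
    have "((\<lambda>s. M * ((1 + s) ^ ?n - (1 - s) ^ ?n)) \<longlongrightarrow> M * ((1 + 0) ^ ?n - (1 - 0) ^ ?n)) (at_right 0)"
      by (intro tendsto_intros)
    then have ev2: "\<forall>\<^sub>F s in at_right 0. M * ((1 + s) ^ ?n - (1 - s) ^ ?n) < e / 2"
      using e by (intro order_tendstoD) auto
    have ev3: "\<forall>\<^sub>F s::real in at_right 0. 0 < s \<and> s < 1 / 2"
      using eventually_at_right_real[of 0 "1 / 2"] by simp
    obtain s where s: "0 < s" "s < 1 / 2" "(1 + s) ^ DIM('a) * ?V - (1 - s) ^ DIM('a) * ?V < \<theta>"
        "M * ((1 + s) ^ ?n - (1 - s) ^ ?n) < e / 2"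
      using eventually_happens'[OF trivial_limit_at_right_real
          eventually_conj[OF ev1 eventually_conj[OF ev2 ev3]]] by blast
    have pow: "(1 / 2) ^ DIM('a) * ?V \<le> (1 - s) ^ DIM('a) * ?V"
      using s V by (intro mult_right_mono power_mono) auto
    have "\<forall>\<^sub>F i in sequentially. ?h (1 - s) ` L \<subseteq> C i \<and> C i \<subseteq> ?h (1 + s) ` L"
      using s by (intro eventually_sandwich[OF C L lim ball]) auto
    then show "\<forall>\<^sub>F i in sequentially. \<forall>t. \<alpha> \<le> t \<and> t \<le> 1 - \<alpha> \<longrightarrow>
       \<bar>norm_profile (C i) t - norm_profile L t\<bar> < e"
    proof (eventually_elim, intro allI impI)
      fix i t
      assume sub: "?h (1 - s) ` L \<subseteq> C i \<and> C i \<subseteq> ?h (1 + s) ` L" and t: "\<alpha> \<le> t \<and> t \<le> 1 - \<alpha>"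
      have t01: "0 \<le> t" "t \<le> 1" using t \<alpha> by auto
      have inner: "?h (1 - s) ` L \<in> sets lebesgue" "measure lebesgue (?h (1 - s) ` L) = (1 - s) ^ DIM('a) * ?V"
        and outer: "?h (1 + s) ` L \<in> sets lebesgue" "measure lebesgue (?h (1 + s) ` L) = (1 + s) ^ DIM('a) * ?V"
        using s by (auto intro!: h_meas hV)
      have outer_K: "?h (1 + s) ` L \<subseteq> K" using s by (intro hK) auto
      have Clm: "C i \<in> lmeasurable" using Cm[of i] by (simp add: bounded_set_imp_lmeasurable)
      have vol1: "measure lebesgue (?h (1 - s) ` L) \<le> measure lebesgue (C i)"
        using sub inner Clm by (intro measure_mono_fmeasurable) auto
      have outer_lm: "?h (1 + s) ` L \<in> lmeasurable"
        using outer(1) outer_K K by (meson bounded_set_imp_lmeasurable bounded_subset)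
      have vol2: "measure lebesgue (C i) \<le> measure lebesgue (?h (1 + s) ` L)"
        using sub Cm outer_lm by (intro measure_mono_fmeasurable) auto
      have CiK: "C i \<subseteq> K" using sub outer_K by (meson order_trans)
      have lower: "(1 - s) ^ ?n * norm_profile L t \<le> norm_profile (C i) t + e / 2"
        using compare[OF Cm(1) CiK inner(1), of t] sub t vol1 vol2 inner outer s pow hJ[of "1 - s" t] t01 by simp
      have upper: "norm_profile (C i) t \<le> (1 + s) ^ ?n * norm_profile L t + e / 2"
        using compare[OF outer(1) outer_K Cm(1), of i t] sub t vol1 vol2 inner outer s pow hJ[of "1 + s" t] t01 by simp
      have J: "0 \<le> norm_profile L t" "norm_profile L t \<le> M"
        using norm_profile_nonneg bound[OF Lm(1) LK t01] by auto
      have p: "(1 - s) ^ ?n \<le> 1" "1 \<le> (1 + s) ^ ?n" using s by (auto intro: power_le_one)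
      have "((1 + s) ^ ?n - 1) * norm_profile L t \<le> ((1 + s) ^ ?n - (1 - s) ^ ?n) * M"
        "(1 - (1 - s) ^ ?n) * norm_profile L t \<le> ((1 + s) ^ ?n - (1 - s) ^ ?n) * M"
        using p J by (auto intro!: mult_mono)
      then show "\<bar>norm_profile (C i) t - norm_profile L t\<bar> < e"
        using lower upper s(4) by (simp add: algebra_simps abs_less_iff)
    qed
  qed
qed

theorem corollary4p4:
  fixes C :: "nat \<Rightarrow> 'a::euclidean_space set" and C_lim :: "'a set"
  assumes "DIM('a) \<ge> 2"
    and "\<And>i. convex_body (C i)"
    and "convex_body C_lim"
    and "(\<lambda>i. hausdorff_dist (C i) C_lim) \<longlonglongrightarrow> 0"
  shows "(\<forall>K. compact K \<and> K \<subseteq> {0<..<1} \<longrightarrow>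
            uniform_limit K (\<lambda>i. norm_profile (C i)) (norm_profile C_lim) sequentially) \<and>
         (\<forall>K. compact K \<and> K \<subseteq> {0<..<1} \<longrightarrow>
            uniform_limit K (\<lambda>i. norm_profile_pow (C i)) (norm_profile_pow C_lim) sequentially)"
proof -
  obtain M where M: "\<And>t. 0 \<le> t \<Longrightarrow> t \<le> 1 \<Longrightarrow> norm_profile C_lim t \<le> M"
    "\<forall>\<^sub>F i in sequentially. \<forall>t. 0 \<le> t \<and> t \<le> 1 \<longrightarrow> norm_profile (C i) t \<le> M"
    "\<And>\<alpha> e. \<alpha> > 0 \<Longrightarrow> e > 0 \<Longrightarrow> \<forall>\<^sub>F i in sequentially. \<forall>t. \<alpha> \<le> t \<and> t \<le> 1 - \<alpha> \<longrightarrow>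
       \<bar>norm_profile (C i) t - norm_profile C_lim t\<bar> < e"
    by (rule norm_profile_convergence[OF assms]) (rule that, blast+)
  have J: "uniform_limit K (\<lambda>i. norm_profile (C i)) (norm_profile C_lim) sequentially"
    if K: "compact K" "K \<subseteq> {0<..<1}" for K
  proof (rule uniform_limitI)
    fix e :: real assume "e > 0"
    have "closed (- {0<..<1::real})" "K \<inter> (- {0<..<1}) = {}" using K(2) by auto
    then obtain \<alpha> where \<alpha>: "\<alpha> > 0" "\<And>x y. x \<in> K \<Longrightarrow> y \<in> - {0<..<1} \<Longrightarrow> \<alpha> \<le> dist x y"
      using separate_compact_closed[OF K(1), of "- {0<..<1}"] by blast
    have mid: "\<alpha> \<le> t \<and> t \<le> 1 - \<alpha>" if "t \<in> K" for t
      using \<alpha>(2)[OF that, of 0] \<alpha>(2)[OF that, of 1] subsetD[OF K(2) that] by (auto simp: dist_real_def)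
    show "\<forall>\<^sub>F i in sequentially. \<forall>t\<in>K. dist (norm_profile (C i) t) (norm_profile C_lim t) < e"
      using M(3)[OF \<alpha>(1) \<open>e > 0\<close>]
      by eventually_elim (use mid in \<open>simp add: dist_real_def\<close>)
  qed
  define p where "p = real DIM('a) / (real DIM('a) - 1)"
  have p: "p > 0" using assms(1) by (simp add: p_def)
  have "uniform_limit K (\<lambda>i. norm_profile_pow (C i)) (norm_profile_pow C_lim) sequentially"
    if K: "compact K" "K \<subseteq> {0<..<1}" for K
  proof -
    have "continuous_on {0..M} (\<lambda>x. x powr p)"
      using p by (intro continuous_on_powr' continuous_intros) auto
    then have uc: "uniformly_continuous_on {0..M} (\<lambda>x. x powr p)"
      by (rule compact_uniformly_continuous) simp
    have ev: "\<forall>\<^sub>F i in sequentially. \<forall>t\<in>K. norm_profile (C i) t \<in> {0..M}"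
      using M(2) by eventually_elim (use K(2) norm_profile_nonneg in force)
    have "uniform_limit K (\<lambda>i t. norm_profile (C i) t powr p) (\<lambda>t. norm_profile C_lim t powr p) sequentially"
      by (rule uniform_limit_compose_uniformly_continuous_on[OF J[OF K] uc ev]) simp
    then show ?thesis by (simp add: norm_profile_pow_def[abs_def] p_def)
  qed
  with J show ?thesis by blast
qed

end
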